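(* Assume that $(E,\mathcal E)$ is a Borel space. Let $\Phi\in L^1(\Omega\times E;H)$ be such that $D_x\Phi\in L^1(\Omega\times E;H)$ for $\mu$-almost all $x\in E$. Then the equality $$D_x\delta(\Phi)=\delta(D_x\Phi)+\Phi(x)$$ holds $\mathbb P\otimes\mu$-almost everywhere.
   Context: Setting: $(E,\mathcal E,\mu)$ is a $\sigma$-finite measure space such that the diagonal $\{(x,y)\in E\times E:x=y\}$ belongs to $\mathcal E\otimes\mathcal E$. $(E,\mathcal E)$ is a Borel space if there is a measurable bijection with measurable inverse from $E$ onto a Borel subset of $[0,1]$. $\mathbf N$ is the space of all $\sigma$-finite $\mathbb N_0\cup\{+\infty\}$-valued measures on $(E,\mathcal E)$ with the $\sigma$-algebra generated by the maps $\eta\mapsto\eta(B)$, $B\in\mathcal E$. $(\Omega,\mathcal F,\mathbb P)$ is a complete probability space, $N:\Omega\to\mathbf N$ is a Poisson random measure with intensity measure $\mu$, represented as $N=\sum_{n=1}^{N(E)}\delta_{X_n}$ with $E$-valued random variables $X_1,X_2,\dots$, and $\mathcal F$ is the $\mathbb P$-completion of $\sigma(N)$. $H$ is a separable real Hilbert space with inner product $\langle\cdot,\cdot\rangle$ and norm $\|\cdot\|$. $L^0(\cdot;H)$ denotes equivalence classes of strongly measurable functions and $L^p(\cdot;H)$ the usual Bochner spaces; product spaces carry product measures ($\Omega$ carries $\mathbb P$, $E$ carries $\mu$). Difference operator: for $F\in L^0(\Omega;H)$, $D_xF:=f(N+\delta_x)-f(N)$, where $f:\mathbf N\to H$ is measurable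 with $F=f(N)$ a.s. For $\Phi\in L^0(\Omega\times E;H)$ with $\Phi(y)=\varphi(N,y)$ $\mathbb P\otimes\mu$-a.e., $\varphi:\mathbf N\times E\to H$ measurable, $D_x\Phi(y):=\varphi(N+\delta_x,y)-\varphi(N,y)$, so $D\Phi\in L^0(\Omega\times E\times E;H)$, and for fixed $x$, $D_x\Phi=(D_x\Phi(y))_{y\in E}$ is a random function on $E$. These are a.e. independent of the representatives. Operator $\varepsilon^-$: for $\eta\in\mathbf N$, $\eta\setminus\delta_x:=\eta-\delta_x$ if $\eta(B)\ge\delta_x(B)$ for all $B\in\mathcal E$, and $\eta\setminus\delta_x:=\eta$ otherwise; $\varepsilon_y^-\Phi(y):=\varphi(N\setminus\delta_y,y)$, which is $\mathbb P\otimes N$-a.e. independent of $\varphi$, where $(\mathbb P\otimes N)(\mathrm d\omega,\mathrm dx)=N(\omega,\mathrm dx)\mathbb P(\mathrm d\omega)$. Pathwise Kabanov–Skorohod integral: $\delta:L^1(\Omega\times E;H)\to L^1(\Omega;H)$, $\delta(\Phi):=\int_E\varepsilon_y^-\Phi(y)\,N(\mathrm dy)-\int_E\Phi(y)\,\mu(\mathrm dy)$ (a.s. defined $H$-valued Bochner integrals). $\delta(D_x\Phi)$ is this integral applied, for $\mu$-almost every fixed $x$, to $D_x\Phi$; the resulting $x$-dependent family is regarded as an element of $L^0(E;L^1(\Omega;H))\subset L^0(\Omega\times E;H)$. *)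

theory Defs
  imports "HOL-Probability.Probability"
begin

definition borel_space :: "'e measure \<Rightarrow> bool" where
  "borel_space M \<longleftrightarrow>
    (\<exists>S g. S \<in> sets (borel :: real measure) \<and> S \<subseteq> {0..1} \<and>
       bij_betw g (space M) S \<and>
       g \<in> measurable M (restrict_space borel S) \<and>
       the_inv_into (space M) g \<in> measurable (restrict_space borel S) M)"

definition measurable_diagonal :: "'e measure \<Rightarrow> bool" where
  "measurable_diagonal M \<longleftrightarrow>
    {(x, y). x \<in> space M \<and> y \<in> space M \<and> x = y} \<in> sets (M \<Otimes>\<^sub>M M)"

text \<open>
  The measurable space \<open>\<^bold>N\<close> of \<open>\<sigma>\<close>-finite measures with values in
  \<open>{0, 1, 2, \<dots>} \<union> {\<infinity>}\<close>, with the \<open>\<sigma>\<close>-algebra generated by the evaluations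
  \<open>\<eta> \<mapsto> \<eta>(B)\<close>; it is built like \<^const>\<open>subprob_algebra\<close>. Only the measurable space
  structure of \<open>M\<close> and of the result is used.
\<close>

definition counting_measures :: "'e measure \<Rightarrow> 'e measure set" where
  "counting_measures M =
    {\<eta>. sets \<eta> = sets M \<and> sigma_finite_measure \<eta> \<and>
        (\<forall>B\<in>sets M. emeasure \<eta> B \<in> insert \<infinity> (range of_nat))}"

definition counting_algebra :: "'e measure \<Rightarrow> 'e measure measure" where
  "counting_algebra M =
    (SUP B \<in> sets M. vimage_algebra (counting_measures M) (\<lambda>\<eta>. emeasure \<eta> B) borel)"

definition poisson_random_measure ::
    "'w measure \<Rightarrow> 'e measure \<Rightarrow> ('w \<Rightarrow> 'e measure) \<Rightarrow> bool" where
  "poisson_random_measure P M N \<longleftrightarrow>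
     N \<in> measurable P (counting_algebra M) \<and>
     (\<forall>B\<in>sets M. emeasure M B < \<infinity> \<longrightarrow>
        (\<forall>k::nat. measure P {\<omega> \<in> space P. emeasure (N \<omega>) B = of_nat k} =
           measure M B ^ k / fact k * exp (- measure M B))) \<and>
     (\<forall>B\<in>sets M. emeasure M B = \<infinity> \<longrightarrow> (AE \<omega> in P. emeasure (N \<omega>) B = \<infinity>)) \<and>
     (\<forall>(B :: nat \<Rightarrow> 'e set) I. finite I \<longrightarrow> B ` I \<subseteq> sets M \<longrightarrow> disjoint_family_on B I \<longrightarrow>
        prob_space.indep_vars P (\<lambda>_. borel) (\<lambda>i \<omega>. emeasure (N \<omega>) (B i)) I)"

text \<open>
  \<open>N = \<Sum>\<^sub>n \<delta>\<^bsub>X n\<^esub>\<close> almost surely, where \<open>n\<close> runs through the first \<open>N(E)\<close> indices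
  (counted from \<open>0\<close>).
\<close>

definition represented_by ::
    "'w measure \<Rightarrow> 'e measure \<Rightarrow> ('w \<Rightarrow> 'e measure) \<Rightarrow> (nat \<Rightarrow> 'w \<Rightarrow> 'e) \<Rightarrow> bool" where
  "represented_by P M N X \<longleftrightarrow>
     (\<forall>n. X n \<in> measurable P M) \<and>
     (AE \<omega> in P. \<forall>B\<in>sets M. emeasure (N \<omega>) B =
        (\<Sum>n. if of_nat n < emeasure (N \<omega>) (space M) then indicator B (X n \<omega>) else 0))"

text \<open>\<open>\<F>\<close> is the \<open>P\<close>-completion of \<open>\<sigma>(N)\<close>.\<close>

definition generated_by ::
    "'w measure \<Rightarrow> 'e measure \<Rightarrow> ('w \<Rightarrow> 'e measure) \<Rightarrow> bool" where
  "generated_by P M N \<longleftrightarrow>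
     sets P = sets (completion (restr_to_subalg P
       (vimage_algebra (space P) N (counting_algebra M))))"

text \<open>\<open>\<eta> + \<delta>\<^sub>x\<close> and \<open>\<eta> \ \<delta>\<^sub>x\<close>; \<open>return \<eta> x\<close> is the Dirac measure at \<open>x\<close> on the
  \<open>\<sigma>\<close>-algebra of \<open>\<eta>\<close>.\<close>

definition add_point :: "'e measure \<Rightarrow> 'e \<Rightarrow> 'e measure" where
  "add_point \<eta> x =
     measure_of (space \<eta>) (sets \<eta>) (\<lambda>B. emeasure \<eta> B + emeasure (return \<eta> x) B)"

definition remove_point :: "'e measure \<Rightarrow> 'e \<Rightarrow> 'e measure" where
  "remove_point \<eta> x =
     (if \<forall>B\<in>sets \<eta>. emeasure (return \<eta> x) B \<le> emeasure \<eta> B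
      then diff_measure \<eta> (return \<eta> x) else \<eta>)"

text \<open>
  Elements of the spaces \<open>L\<^sup>0\<close> are rendered by functions, and equality in \<open>L\<^sup>0\<close> by almost
  everywhere equality. The operators below pick some representing function on \<open>\<^bold>N\<close>
  (respectively \<open>\<^bold>N \<times> E\<close>). In the setting considered here, representing functions exist because
  \<open>\<F>\<close> is the completion of \<open>\<sigma>(N)\<close>, and the results do not depend on the choice up to
  null sets.
\<close>

definition represents\<^sub>\<Omega> ::
    "'w measure \<Rightarrow> 'e measure \<Rightarrow> ('w \<Rightarrow> 'e measure) \<Rightarrow>
     ('w \<Rightarrow> 'h::topological_space) \<Rightarrow> ('e measure \<Rightarrow> 'h) \<Rightarrow> bool" where
  "represents\<^sub>\<Omega> P M N F f \<longleftrightarrow>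
     f \<in> measurable (counting_algebra M) borel \<and> (AE \<omega> in P. F \<omega> = f (N \<omega>))"

definition represents\<^sub>\<Omega>\<^sub>E ::
    "'w measure \<Rightarrow> 'e measure \<Rightarrow> ('w \<Rightarrow> 'e measure) \<Rightarrow>
     ('w \<times> 'e \<Rightarrow> 'h::topological_space) \<Rightarrow> ('e measure \<times> 'e \<Rightarrow> 'h) \<Rightarrow> bool" where
  "represents\<^sub>\<Omega>\<^sub>E P M N \<Phi> \<phi> \<longleftrightarrow>
     \<phi> \<in> measurable (counting_algebra M \<Otimes>\<^sub>M M) borel \<and>
     (AE (\<omega>, y) in P \<Otimes>\<^sub>M M. \<Phi> (\<omega>, y) = \<phi> (N \<omega>, y))"

definition difference\<^sub>\<Omega> ::
    "'w measure \<Rightarrow> 'e measure \<Rightarrow> ('w \<Rightarrow> 'e measure) \<Rightarrow>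
     ('w \<Rightarrow> 'h::{topological_space,minus}) \<Rightarrow> 'e \<Rightarrow> 'w \<Rightarrow> 'h" where
  "difference\<^sub>\<Omega> P M N F =
     (let f = (SOME f. represents\<^sub>\<Omega> P M N F f)
      in (\<lambda>x \<omega>. f (add_point (N \<omega>) x) - f (N \<omega>)))"

definition difference\<^sub>\<Omega>\<^sub>E ::
    "'w measure \<Rightarrow> 'e measure \<Rightarrow> ('w \<Rightarrow> 'e measure) \<Rightarrow>
     ('w \<times> 'e \<Rightarrow> 'h::{topological_space,minus}) \<Rightarrow> 'e \<Rightarrow> 'w \<times> 'e \<Rightarrow> 'h" where
  "difference\<^sub>\<Omega>\<^sub>E P M N \<Phi> =
     (let \<phi> = (SOME \<phi>. represents\<^sub>\<Omega>\<^sub>E P M N \<Phi> \<phi>)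
      in (\<lambda>x (\<omega>, y). \<phi> (add_point (N \<omega>) x, y) - \<phi> (N \<omega>, y)))"

definition eps_minus ::
    "'w measure \<Rightarrow> 'e measure \<Rightarrow> ('w \<Rightarrow> 'e measure) \<Rightarrow>
     ('w \<times> 'e \<Rightarrow> 'h::topological_space) \<Rightarrow> 'w \<times> 'e \<Rightarrow> 'h" where
  "eps_minus P M N \<Phi> =
     (let \<phi> = (SOME \<phi>. represents\<^sub>\<Omega>\<^sub>E P M N \<Phi> \<phi>)
      in (\<lambda>(\<omega>, y). \<phi> (remove_point (N \<omega>) y, y)))"

definition kabanov_skorohod ::
    "'w measure \<Rightarrow> 'e measure \<Rightarrow> ('w \<Rightarrow> 'e measure) \<Rightarrow>
     ('w \<times> 'e \<Rightarrow> 'h::{banach,second_countable_topology}) \<Rightarrow> 'w \<Rightarrow> 'h" where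
  "kabanov_skorohod P M N \<Phi> \<omega> =
     (\<integral>y. eps_minus P M N \<Phi> (\<omega>, y) \<partial>(N \<omega>)) - (\<integral>y. \<Phi> (\<omega>, y) \<partial>M)"

text \<open>
  A family \<open>K x\<close> of random variables, each determined only up to an \<open>x\<close>-dependent null set,
  regarded as an element of \<open>L\<^sup>0(\<Omega> \<times> E)\<close>: a jointly measurable function whose section at
  \<open>x\<close> is almost surely \<open>K x\<close>, for almost every \<open>x\<close>. By Fubini it is unique up to
  null sets of the product. The uncorrected family need not agree with it almost everywhere on
  the product, as the exceptional null sets may depend non-measurably on \<open>x\<close>.
\<close>

definition joint_version ::
    "'w measure \<Rightarrow> 'e measure \<Rightarrow> ('e \<Rightarrow> 'w \<Rightarrow> 'h::topological_space) \<Rightarrow> 'w \<times> 'e \<Rightarrow> 'h" where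
  "joint_version P M K =
     (SOME G. G \<in> borel_measurable (P \<Otimes>\<^sub>M M) \<and>
        (AE x in M. AE \<omega> in P. G (\<omega>, x) = K x \<omega>))"

end

theory Submission
  imports Defs
begin

text \<open>
  Write \<open>\<Phi>(y) = \<phi>(N, y)\<close> with a measurable function \<open>\<phi>\<close> on \<open>\<^bold>N \<times> E\<close>. Then \<open>\<delta>(\<Phi>)\<close> is the
  value at \<open>\<eta> = N\<close> of the function
  \<open>S\<^sub>\<phi>(\<eta>) = \<integral>\<phi>(\<eta> \ \<delta>\<^sub>y, y) \<eta>(dy) - \<integral>\<phi>(\<eta>, y) \<mu>(dy)\<close>,
  and the identity becomes one about a single configuration \<open>\<eta>\<close>. When a point \<open>x\<close> is added to
  \<open>\<eta>\<close>, the first integral receives a new term, \<open>\<phi>(\<eta>, x)\<close>, which becomes \<open>\<Phi>(x)\<close>. At each old point \<open>y\<close>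
  the operations commute, \<open>(\<eta> + \<delta>\<^sub>x) \ \<delta>\<^sub>y = \<eta> \ \<delta>\<^sub>y + \<delta>\<^sub>x\<close>, so the
  remaining change is \<open>S\<close> of the function \<open>(\<eta>, y) \<mapsto> \<phi>(\<eta> + \<delta>\<^sub>x, y) - \<phi>(\<eta>, y)\<close>, which
  represents \<open>D\<^sub>x\<Phi>\<close>. This is the lemma \<open>skorohod_add_point\<close>.

  What remains is to justify that the operators, defined through arbitrary representing
  functions, may be computed with these particular ones, and that all integrals exist. Both rest
  on the Mecke equation (theorem \<open>mecke\<close>)
  \<open>E \<integral>f(N, y) N(dy) = E \<integral>f(N + \<delta>\<^sub>y, y) \<mu>(dy)\<close>.
  Applied to indicators, it shows that a null set for \<open>N\<close> is one for \<open>N + \<delta>\<^sub>x\<close> at almost every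
  \<open>x\<close>, and that a null set for \<open>(N, y)\<close> is one for \<open>(N \ \<delta>\<^sub>y, y)\<close> at \<open>N\<close>-almost every \<open>y\<close>.
  Applied to norms, it bounds the integrals of \<open>\<epsilon>\<^sup>-\<close> by \<open>L\<^sup>1\<close> norms over \<open>\<Omega> \<times> E\<close>. The Mecke equation
  itself is the identity \<open>(k + 1) p(k + 1) = \<lambda> p(k)\<close> for Poisson weights, applied on the finitely many
  atoms on which a cylinder set of counting measures depends.

  The second source of work is measurability. \<open>\<sigma>\<close>-finite counting measures do not share an
  exhausting sequence, and integrals \<open>\<integral>g(\<eta>, y) \<eta>(dy)\<close> are treated only for those \<open>\<eta>\<close> that are
  finite on fixed sets \<open>B n\<close> of finite intensity; almost every realization is of this kind. Then
  \<open>S\<^sub>\<phi>\<close> is measurable, hence represents \<open>\<delta>(\<Phi>)\<close>, and \<open>\<delta>(D\<^sub>x\<Phi>)\<close> has a version that is explicit and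
  jointly measurable in \<open>(\<omega>, x)\<close>; by Fubini's theorem it agrees with the chosen one.
\<close>

section \<open>Functions of the point process\<close>

text \<open>
  A Doob--Dynkin lemma up to null sets. A target that is merely a Banach space has no order to
  work with, so \<open>F\<close> is approximated by simple functions: each level set is almost a preimage
  under \<open>T\<close>, hence each approximant is almost a function of \<open>T\<close>, and so is the limit.
\<close>
lemma AE_factorization:
  fixes F :: "'a \<Rightarrow> 'h::{banach, second_countable_topology}"
  assumes T[measurable]: "T \<in> measurable Q K"
    and pull: "\<And>A. A \<in> sets Q \<Longrightarrow> \<exists>C\<in>sets K. AE q in Q. q \<in> A \<longleftrightarrow> T q \<in> C"
    and F: "F \<in> borel_measurable Q"
  obtains f where "f \<in> borel_measurable K" "AE q in Q. F q = f (T q)"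
proof -
  from borel_measurable_implies_sequence_metric[OF F, of 0] obtain s where
    s: "\<And>i. simple_function Q (s i)" and
    lim: "\<And>q. q \<in> space Q \<Longrightarrow> (\<lambda>i. s i q) \<longlonglongrightarrow> F q"
    by metis
  have "\<exists>C\<in>sets K. AE q in Q. q \<in> s i -` {v} \<inter> space Q \<longleftrightarrow> T q \<in> C" for i v
    using pull[of "s i -` {v} \<inter> space Q"] simple_functionD(2)[OF s] by blast
  then obtain C where C[measurable]: "\<And>i v. C i v \<in> sets K"
    and C_AE: "\<And>i v. AE q in Q. q \<in> s i -` {v} \<inter> space Q \<longleftrightarrow> T q \<in> C i v"
    by metis
  define t where "t i k = (\<Sum>v\<in>s i ` space Q. indicator (C i v) k *\<^sub>R v)" for i k
  have t[measurable]: "t i \<in> borel_measurable K" for i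
    unfolding t_def by measurable
  have "AE q in Q. \<forall>v\<in>s i ` space Q. q \<in> s i -` {v} \<inter> space Q \<longleftrightarrow> T q \<in> C i v" for i
    using C_AE simple_functionD(1)[OF s] by (intro AE_finite_allI) auto
  then have "AE q in Q. \<forall>i. \<forall>v\<in>s i ` space Q. q \<in> s i -` {v} \<inter> space Q \<longleftrightarrow> T q \<in> C i v"
    by (simp add: AE_all_countable)
  then have "AE q in Q. F q = lim (\<lambda>i. t i (T q))"
    using AE_space
  proof eventually_elim
    case (elim q)
    have "t i (T q) = s i q" for i
    proof -
      have "t i (T q) = (\<Sum>v\<in>s i ` space Q. if v = s i q then v else 0)"
        unfolding t_def
      proof (intro sum.cong refl)
        fix v assume "v \<in> s i ` space Q"
        with elim(1) have "q \<in> s i -` {v} \<inter> space Q \<longleftrightarrow> T q \<in> C i v"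
          by (rule bspec[OF spec[of _ i]])
        with elim(2) have "T q \<in> C i v \<longleftrightarrow> v = s i q"
          by auto
        then show "indicator (C i v) (T q) *\<^sub>R v = (if v = s i q then v else 0)"
          by (cases "v = s i q") auto
      qed
      also have "\<dots> = s i q"
        using simple_functionD(1)[OF s] elim by (simp add: sum.delta)
      finally show ?thesis .
    qed
    with lim[of q] elim show ?case
      by (simp add: limI)
  qed
  then show ?thesis
    by (intro that[of "\<lambda>k. lim (\<lambda>i. t i k)"]) auto
qed

lemma AE_pair_fst:
  assumes "sigma_finite_measure M" and "AE q in Q. R q"
  shows "AE q in Q \<Otimes>\<^sub>M M. R (fst q)"
proof -
  interpret M: sigma_finite_measure M by fact
  from assms(2) obtain Z where Z: "Z \<in> null_sets Q" "{q\<in>space Q. \<not> R q} \<subseteq> Z"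
    by (auto simp: eventually_ae_filter)
  show ?thesis
    by (rule AE_I'[OF M.times_in_null_sets1[OF Z(1) sets.top]])
      (use Z(2) in \<open>auto simp: space_pair_measure\<close>)
qed

text \<open>
  Passes the hypothesis of the factorization lemma from \<open>Q\<close> to a product: the sets that
  are preimages up to null sets form a \<open>\<sigma>\<close>-algebra containing the rectangles. This is
  what makes an integrand on \<open>\<Omega> \<times> E\<close> a function of the point process and the position.
\<close>
lemma pull_back_pair:
  assumes T[measurable]: "T \<in> measurable Q K"
    and pull: "\<And>A. A \<in> sets Q \<Longrightarrow> \<exists>C\<in>sets K. AE q in Q. q \<in> A \<longleftrightarrow> T q \<in> C"
    and M: "sigma_finite_measure M"
    and A: "A \<in> sets (Q \<Otimes>\<^sub>M M)"
  shows "\<exists>C\<in>sets (K \<Otimes>\<^sub>M M). AE q in Q \<Otimes>\<^sub>M M. q \<in> A \<longleftrightarrow> (T (fst q), snd q) \<in> C"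
proof -
  interpret M: sigma_finite_measure M by fact
  show ?thesis
    using A unfolding sets_pair_measure
  proof (induction rule: sigma_sets.induct)
    case (Basic a)
    then obtain b c where a: "a = b \<times> c" and [measurable]: "b \<in> sets Q" "c \<in> sets M"
      by auto
    from pull[of b] obtain d where [measurable]: "d \<in> sets K" and d: "AE q in Q. q \<in> b \<longleftrightarrow> T q \<in> d"
      by auto
    have "AE q in Q \<Otimes>\<^sub>M M. fst q \<in> b \<longleftrightarrow> T (fst q) \<in> d"
      using M d by (rule AE_pair_fst)
    then show ?case
      by (intro bexI[of _ "d \<times> c"]) (auto simp: a sets_pair_measure[symmetric])
  next
    case Empty
    then show ?case by (intro bexI[of _ "{}"]) auto
  next
    case (Compl a)
    then obtain C where C: "C \<in> sets (K \<Otimes>\<^sub>M M)"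
      "AE q in Q \<Otimes>\<^sub>M M. q \<in> a \<longleftrightarrow> (T (fst q), snd q) \<in> C"
      by (auto simp: sets_pair_measure)
    have "AE q in Q \<Otimes>\<^sub>M M. q \<in> space Q \<times> space M - a \<longleftrightarrow> (T (fst q), snd q) \<in> space (K \<Otimes>\<^sub>M M) - C"
      using C(2) AE_space
      by eventually_elim (use measurable_space[OF T] in \<open>auto simp: space_pair_measure\<close>)
    with C(1) show ?case
      by (intro bexI[of _ "space (K \<Otimes>\<^sub>M M) - C"]) (auto simp: sets_pair_measure[symmetric])
  next
    case (Union a)
    then have "\<forall>i. \<exists>C. C \<in> sets (K \<Otimes>\<^sub>M M) \<and> (AE q in Q \<Otimes>\<^sub>M M. q \<in> a i \<longleftrightarrow> (T (fst q), snd q) \<in> C)"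
      by (auto simp: sets_pair_measure Bex_def)
    from choice[OF this] obtain C where C: "\<And>i::nat. C i \<in> sets (K \<Otimes>\<^sub>M M)"
      "\<And>i. AE q in Q \<Otimes>\<^sub>M M. q \<in> a i \<longleftrightarrow> (T (fst q), snd q) \<in> C i"
      by auto
    have "AE q in Q \<Otimes>\<^sub>M M. \<forall>i. q \<in> a i \<longleftrightarrow> (T (fst q), snd q) \<in> C i"
      using C(2) by (simp add: AE_all_countable)
    then have "AE q in Q \<Otimes>\<^sub>M M. q \<in> \<Union>(range a) \<longleftrightarrow> (T (fst q), snd q) \<in> (\<Union>i. C i)"
      by eventually_elim (simp del: split_paired_All)
    with C(1) show ?case
      by (intro bexI[of _ "\<Union>i. C i"]) (auto simp: sets_pair_measure[symmetric])
  qed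
qed

lemma generated_by_pull_back:
  assumes N: "N \<in> measurable P (counting_algebra M)"
    and gen: "generated_by P M N"
    and A: "A \<in> sets P"
  shows "\<exists>C\<in>sets (counting_algebra M). AE \<omega> in P. \<omega> \<in> A \<longleftrightarrow> N \<omega> \<in> C"
proof -
  let ?V = "vimage_algebra (space P) N (counting_algebra M)"
  have sub: "subalgebra P ?V"
    using N by (auto simp: subalgebra_def sets_vimage_algebra2 measurable_def)
  from A gen have "A \<in> sets (completion (restr_to_subalg P ?V))"
    by (simp add: generated_by_def)
  then obtain S Z Z' where A: "A = S \<union> Z" "Z \<subseteq> Z'" and Z': "Z' \<in> null_sets (restr_to_subalg P ?V)"
    and S: "S \<in> sets (restr_to_subalg P ?V)"
    by (rule sets_completionE)
  from Z' have "Z' \<in> null_sets P"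
    by (simp add: null_sets_restr_to_subalg[OF sub])
  then have Z': "AE \<omega> in P. \<omega> \<notin> Z'"
    by (rule AE_not_in)
  from S obtain C where C: "C \<in> sets (counting_algebra M)" "S = N -` C \<inter> space P"
    using N by (auto simp: sets_restr_to_subalg[OF sub] sets_vimage_algebra2 measurable_def)
  have "AE \<omega> in P. \<omega> \<in> A \<longleftrightarrow> N \<omega> \<in> C"
    using Z' AE_space by eventually_elim (use A C in auto)
  with C show ?thesis by auto
qed

section \<open>Counting measures\<close>

lemma space_counting_algebra: "space (counting_algebra M) = counting_measures M"
  by (auto simp: counting_algebra_def space_Sup_eq_UN)

lemma measurable_emeasure_counting_algebra[measurable]:
  "C \<in> sets M \<Longrightarrow> (\<lambda>\<eta>. emeasure \<eta> C) \<in> borel_measurable (counting_algebra M)"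
  by (auto intro!: measurable_Sup1 measurable_vimage_algebra1 simp: counting_algebra_def)

text \<open>
  The \<open>\<sigma>\<close>-algebra is initial with respect to the evaluations, so measurability into it
  can be tested on them.
\<close>
lemma measurable_counting_algebra:
  assumes "\<And>z. z \<in> space L \<Longrightarrow> \<kappa> z \<in> counting_measures M"
    and "\<And>C. C \<in> sets M \<Longrightarrow> (\<lambda>z. emeasure (\<kappa> z) C) \<in> borel_measurable L"
  shows "\<kappa> \<in> measurable L (counting_algebra M)"
  using assms by (auto intro!: measurable_Sup2 measurable_vimage_algebra2 simp: counting_algebra_def)

lemma sets_counting_measure: "\<eta> \<in> counting_measures M \<Longrightarrow> sets \<eta> = sets M"
  by (simp add: counting_measures_def)

lemma space_counting_measure: "\<eta> \<in> counting_measures M \<Longrightarrow> space \<eta> = space M"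
  by (metis sets_counting_measure sets_eq_imp_space_eq)

section \<open>Integration against a kernel\<close>

text \<open>
  The kernels of interest send a parameter to a measure that need not be finite, but all
  these measures are finite on the sets of one common exhausting sequence. This uniformity
  is what measurability of integrals in the parameter rests on; for measures that are only
  individually \<open>\<sigma>\<close>-finite there is no sequence along which to take the limit.
\<close>

locale finite_on_exhaustion_kernel =
  fixes L :: "'z measure" and M :: "'e measure" and B :: "nat \<Rightarrow> 'e set"
    and \<kappa> :: "'z \<Rightarrow> 'e measure"
  assumes B_sets[measurable]: "\<And>n. B n \<in> sets M"
    and B_incseq: "incseq B"
    and B_exhausts: "(\<Union>n. B n) = space M"
    and sets_\<kappa>: "\<And>z. z \<in> space L \<Longrightarrow> sets (\<kappa> z) = sets M"
    and measurable_\<kappa>[measurable]: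
      "\<And>C. C \<in> sets M \<Longrightarrow> (\<lambda>z. emeasure (\<kappa> z) C) \<in> borel_measurable L"
    and finite_\<kappa>: "\<And>z n. z \<in> space L \<Longrightarrow> emeasure (\<kappa> z) (B n) < \<infinity>"
begin

text \<open>
  The restriction to \<open>B n\<close> with its mass scaled below one, which turns the \<open>n\<close>-th part
  of the kernel into a subprobability kernel, for which measurability of integrals is known.
\<close>
definition scaled_kernel :: "nat \<Rightarrow> 'z \<Rightarrow> 'e measure" where
  "scaled_kernel n z = density (\<kappa> z) (\<lambda>y. indicator (B n) y / (1 + emeasure (\<kappa> z) (B n)))"

lemma space_\<kappa>: "z \<in> space L \<Longrightarrow> space (\<kappa> z) = space M"
  using sets_\<kappa> sets_eq_imp_space_eq by blast

lemma emeasure_scaled_kernel: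
  assumes z: "z \<in> space L" and C: "C \<in> sets M"
  shows "emeasure (scaled_kernel n z) C = emeasure (\<kappa> z) (C \<inter> B n) / (1 + emeasure (\<kappa> z) (B n))"
proof -
  note [simp] = sets_\<kappa>[OF z]
  have "emeasure (scaled_kernel n z) C =
      (\<integral>\<^sup>+y. indicator (C \<inter> B n) y / (1 + emeasure (\<kappa> z) (B n)) \<partial>\<kappa> z)"
    unfolding scaled_kernel_def using C
    by (subst emeasure_density)
      (auto intro!: nn_integral_cong simp: indicator_def measurable_cong_sets[OF sets_\<kappa>[OF z] refl])
  also have "\<dots> = emeasure (\<kappa> z) (C \<inter> B n) / (1 + emeasure (\<kappa> z) (B n))"
    using C by (subst nn_integral_divide) (auto simp: measurable_cong_sets[OF sets_\<kappa>[OF z] refl])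
  finally show ?thesis .
qed

lemma scaled_kernel_subprob:
  assumes ne: "space M \<noteq> {}"
  shows "scaled_kernel n \<in> measurable L (subprob_algebra M)"
proof (rule measurable_subprob_algebra)
  fix z assume z: "z \<in> space L"
  show sets: "sets (scaled_kernel n z) = sets M"
    using sets_\<kappa>[OF z] by (simp add: scaled_kernel_def)
  have "emeasure (scaled_kernel n z) (space M) \<le> 1"
    using z finite_\<kappa>[OF z, of n]
    by (auto simp: emeasure_scaled_kernel intro!: divide_le_posI_ennreal
        simp: add_pos_nonneg  sets.Int_space_eq1)
  then show "subprob_space (scaled_kernel n z)"
    using ne sets_eq_imp_space_eq[OF sets] by (intro subprob_spaceI) auto
next
  fix C assume [measurable]: "C \<in> sets M"
  show "(\<lambda>z. emeasure (scaled_kernel n z) C) \<in> borel_measurable L"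
    by (subst measurable_cong[OF emeasure_scaled_kernel]) auto
qed

lemma nn_integral_scaled_kernel:
  assumes z: "z \<in> space L" and g: "g \<in> borel_measurable M"
  shows "(\<integral>\<^sup>+y. g y * indicator (B n) y \<partial>\<kappa> z) = (1 + emeasure (\<kappa> z) (B n)) * (\<integral>\<^sup>+y. g y \<partial>scaled_kernel n z)"
proof -
  have g'[measurable]: "g \<in> borel_measurable (\<kappa> z)" "B n \<in> sets (\<kappa> z)"
    using g by (auto simp: measurable_cong_sets[OF sets_\<kappa>[OF z] refl] sets_\<kappa>[OF z])
  have "(1 + emeasure (\<kappa> z) (B n)) * (\<integral>\<^sup>+y. g y \<partial>scaled_kernel n z) =
    (\<integral>\<^sup>+y. (1 + emeasure (\<kappa> z) (B n)) * (indicator (B n) y / (1 + emeasure (\<kappa> z) (B n)) * g y) \<partial>\<kappa> z)"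
    unfolding scaled_kernel_def by (subst nn_integral_density) (auto simp: nn_integral_cmult)
  also have "\<dots> = (\<integral>\<^sup>+y. g y * indicator (B n) y \<partial>\<kappa> z)"
  proof (intro nn_integral_cong)
    fix y
    have "(1 + emeasure (\<kappa> z) (B n)) / (1 + emeasure (\<kappa> z) (B n)) = 1"
      using finite_\<kappa>[OF z, of n] by (intro ennreal_divide_self) auto
    then show "(1 + emeasure (\<kappa> z) (B n)) * (indicator (B n) y / (1 + emeasure (\<kappa> z) (B n)) * g y) =
      g y * indicator (B n) y"
      by (auto simp: indicator_def divide_ennreal_def mult.assoc[symmetric])
  qed
  finally show ?thesis ..
qed

lemma borel_measurable_nn_integral_kernel:
  assumes g[measurable]: "g \<in> borel_measurable (L \<Otimes>\<^sub>M M)"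
  shows "(\<lambda>z. \<integral>\<^sup>+y. g (z, y) \<partial>\<kappa> z) \<in> borel_measurable L"
proof (cases "space M = {}")
  case True
  then show ?thesis
    by (subst measurable_cong[where g="\<lambda>_. 0"]) (auto simp: space_\<kappa> nn_integral_empty)
next
  case False
  have [measurable]: "scaled_kernel n \<in> measurable L (subprob_algebra M)" for n
    by (rule scaled_kernel_subprob[OF False])
  have eq: "(\<integral>\<^sup>+y. g (z, y) \<partial>\<kappa> z) =
      (SUP n. (1 + emeasure (\<kappa> z) (B n)) * (\<integral>\<^sup>+y. g (z, y) \<partial>scaled_kernel n z))"
    if z: "z \<in> space L" for z
  proof -
    have gz: "(\<lambda>y. g (z, y)) \<in> borel_measurable M"
      using z by measurable
    then have gz'[measurable]: "(\<lambda>y. g (z, y)) \<in> borel_measurable (\<kappa> z)" "B n \<in> sets (\<kappa> z)" for n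
      by (auto simp: measurable_cong_sets[OF sets_\<kappa>[OF z] refl] sets_\<kappa>[OF z])
    have "(\<integral>\<^sup>+y. g (z, y) \<partial>\<kappa> z) = (\<integral>\<^sup>+y. (SUP n. g (z, y) * indicator (B n) y) \<partial>\<kappa> z)"
    proof (intro nn_integral_cong)
      fix y assume "y \<in> space (\<kappa> z)"
      then obtain m where "y \<in> B m"
        using B_exhausts space_\<kappa>[OF z] by auto
      show "g (z, y) = (SUP n. g (z, y) * indicator (B n) y)"
      proof (rule antisym)
        show "g (z, y) \<le> (SUP n. g (z, y) * indicator (B n) y)"
          using \<open>y \<in> B m\<close> by (intro SUP_upper2[of m]) auto
        show "(SUP n. g (z, y) * indicator (B n) y) \<le> g (z, y)"
          by (intro SUP_least) (auto simp: indicator_def)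
      qed
    qed
    also have "\<dots> = (SUP n. \<integral>\<^sup>+y. g (z, y) * indicator (B n) y \<partial>\<kappa> z)"
      using B_incseq
      by (intro nn_integral_monotone_convergence_SUP)
        (auto simp: incseq_def le_fun_def indicator_def)
    also have "\<dots> = (SUP n. (1 + emeasure (\<kappa> z) (B n)) * (\<integral>\<^sup>+y. g (z, y) \<partial>scaled_kernel n z))"
      by (simp add: nn_integral_scaled_kernel[OF z gz])
    finally show ?thesis .
  qed
  have [measurable]: "(\<lambda>z. \<integral>\<^sup>+y. g (z, y) \<partial>scaled_kernel n z) \<in> borel_measurable L" for n
    by (rule nn_integral_measurable_subprob_algebra2[where N=M]) auto
  show ?thesis
    by (subst measurable_cong[OF eq]) auto
qed

text \<open>
  Where \<open>g (z, \<cdot>)\<close> is integrable, its integral is the limit of the integrals over \<open>B n\<close>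
  by dominated convergence. Elsewhere the limit may exist without being the integral, whose
  value is then \<open>0\<close> by convention; the set of such \<open>z\<close> is measurable by the nonnegative case.
\<close>
lemma borel_measurable_integral_kernel:
  fixes g :: "'z \<times> 'e \<Rightarrow> 'h::{banach, second_countable_topology}"
  assumes g[measurable]: "g \<in> borel_measurable (L \<Otimes>\<^sub>M M)"
  shows "(\<lambda>z. \<integral>y. g (z, y) \<partial>\<kappa> z) \<in> borel_measurable L"
proof (cases "space M = {}")
  case True
  then show ?thesis
    by (subst measurable_cong[where g="\<lambda>_. 0"]) (auto simp: space_\<kappa> Bochner_Integration.integral_empty)
next
  case False
  have [measurable]: "scaled_kernel n \<in> measurable L (subprob_algebra M)" for n
    by (rule scaled_kernel_subprob[OF False])
  have [measurable]: "(\<lambda>z. \<integral>\<^sup>+y. norm (g (z, y)) \<partial>\<kappa> z) \<in> borel_measurable L"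
    by (rule borel_measurable_nn_integral_kernel[of "\<lambda>p. ennreal (norm (g p))"]) auto
  have eq: "(\<integral>y. g (z, y) \<partial>\<kappa> z) = (if (\<integral>\<^sup>+y. norm (g (z, y)) \<partial>\<kappa> z) < \<infinity>
      then lim (\<lambda>n. (1 + measure (\<kappa> z) (B n)) *\<^sub>R (\<integral>y. g (z, y) \<partial>scaled_kernel n z)) else 0)"
    if z: "z \<in> space L" for z
  proof -
    have "(\<lambda>y. g (z, y)) \<in> borel_measurable M"
      using z by measurable
    then have gz'[measurable]: "(\<lambda>y. g (z, y)) \<in> borel_measurable (\<kappa> z)" "B n \<in> sets (\<kappa> z)" for n
      by (auto simp: measurable_cong_sets[OF sets_\<kappa>[OF z] refl] sets_\<kappa>[OF z])
    show ?thesis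
    proof (cases "(\<integral>\<^sup>+y. norm (g (z, y)) \<partial>\<kappa> z) < \<infinity>")
      case True
      then have int: "integrable (\<kappa> z) (\<lambda>y. g (z, y))"
        by (intro integrableI_bounded) auto
      have "(\<lambda>n. \<integral>y. indicator (B n) y *\<^sub>R g (z, y) \<partial>\<kappa> z) \<longlonglongrightarrow> (\<integral>y. g (z, y) \<partial>\<kappa> z)"
      proof (rule integral_dominated_convergence[where w="\<lambda>y. norm (g (z, y))"])
        show "AE y in \<kappa> z. (\<lambda>n. indicator (B n) y *\<^sub>R g (z, y)) \<longlonglongrightarrow> g (z, y)"
        proof (rule AE_I2)
          fix y assume "y \<in> space (\<kappa> z)"
          then obtain m where m: "y \<in> B m"
            using B_exhausts space_\<kappa>[OF z] by auto
          have "y \<in> B n" if "m \<le> n" for n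
            using m incseqD[OF B_incseq that] by auto
          then show "(\<lambda>n. indicator (B n) y *\<^sub>R g (z, y)) \<longlonglongrightarrow> g (z, y)"
            by (intro tendsto_eventually eventually_sequentiallyI[of m]) auto
        qed
      qed (use int in \<open>auto simp: indicator_def\<close>)
      moreover have "(\<integral>y. indicator (B n) y *\<^sub>R g (z, y) \<partial>\<kappa> z) =
          (1 + measure (\<kappa> z) (B n)) *\<^sub>R (\<integral>y. g (z, y) \<partial>scaled_kernel n z)" for n
      proof -
        have c: "emeasure (\<kappa> z) (B n) = ennreal (measure (\<kappa> z) (B n))"
          using finite_\<kappa>[OF z, of n] by (intro emeasure_eq_ennreal_measure) auto
        have dens: "indicator (B n) y / (1 + emeasure (\<kappa> z) (B n)) =
            ennreal (indicator (B n) y / (1 + measure (\<kappa> z) (B n)))" for y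
        proof -
          have "1 + ennreal (measure (\<kappa> z) (B n)) = ennreal (1 + measure (\<kappa> z) (B n))"
            by (simp add: ennreal_plus)
          then show ?thesis
            unfolding c ennreal_indicator[symmetric]
            by (simp only:) (intro divide_ennreal add_pos_nonneg, auto)
        qed
        have "(\<integral>y. g (z, y) \<partial>scaled_kernel n z) =
            (\<integral>y. (indicator (B n) y / (1 + measure (\<kappa> z) (B n))) *\<^sub>R g (z, y) \<partial>\<kappa> z)"
          unfolding scaled_kernel_def dens
          by (intro integral_density) (auto intro!: AE_I2 divide_nonneg_pos add_pos_nonneg)
        also have "\<dots> = (\<integral>y. (1 / (1 + measure (\<kappa> z) (B n))) *\<^sub>R (indicator (B n) y *\<^sub>R g (z, y)) \<partial>\<kappa> z)"
          by simp
        also have "\<dots> = (1 / (1 + measure (\<kappa> z) (B n))) *\<^sub>R (\<integral>y. indicator (B n) y *\<^sub>R g (z, y) \<partial>\<kappa> z)"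
          by (rule integral_scaleR_right)
        finally show ?thesis
          using measure_nonneg[of "\<kappa> z" "B n"] by (simp add: add_nonneg_eq_0_iff)
      qed
      ultimately show ?thesis
        using True by (simp add: limI)
    next
      case False
      then have "\<not> integrable (\<kappa> z) (\<lambda>y. g (z, y))"
        by (auto simp: integrable_iff_bounded)
      with False show ?thesis
        by (simp add: not_integrable_integral_eq)
    qed
  qed
  have [measurable]: "(\<lambda>z. \<integral>y. g (z, y) \<partial>scaled_kernel n z) \<in> borel_measurable L" for n
  proof -
    have "(\<lambda>z. distr (scaled_kernel n z) (L \<Otimes>\<^sub>M M) (\<lambda>y. (z, y))) \<in> measurable L (subprob_algebra (L \<Otimes>\<^sub>M M))"
      by (rule measurable_distr2[where M=M]) auto
    then have "(\<lambda>z. integral\<^sup>L (distr (scaled_kernel n z) (L \<Otimes>\<^sub>M M) (\<lambda>y. (z, y))) g) \<in> borel_measurable L"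
      by (rule measurable_compose) measurable
    also have "?this \<longleftrightarrow> ?thesis"
    proof (rule measurable_cong)
      fix z assume z: "z \<in> space L"
      have sets: "sets (scaled_kernel n z) = sets M"
        using sets_\<kappa>[OF z] by (simp add: scaled_kernel_def)
      show "integral\<^sup>L (distr (scaled_kernel n z) (L \<Otimes>\<^sub>M M) (\<lambda>y. (z, y))) g = (\<integral>y. g (z, y) \<partial>scaled_kernel n z)"
        using z by (intro integral_distr) (auto simp: measurable_cong_sets[OF sets refl])
    qed
    finally show ?thesis .
  qed
  have [measurable]: "(\<lambda>z. measure (\<kappa> z) (B n)) \<in> borel_measurable L" for n
    unfolding measure_def by measurable
  show ?thesis
    by (subst measurable_cong[OF eq]) auto
qed

end

section \<open>Adding and removing points\<close>

lemma measurable_diagonal_singleton: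
  assumes "measurable_diagonal M" "x \<in> space M"
  shows "{x} \<in> sets M"
proof -
  have "Pair x -` {(x, y). x \<in> space M \<and> y \<in> space M \<and> x = y} \<in> sets M"
    using assms(1) unfolding measurable_diagonal_def by (rule sets_Pair1)
  also have "Pair x -` {(x, y). x \<in> space M \<and> y \<in> space M \<and> x = y} = {x}"
    using assms(2) by auto
  finally show ?thesis .
qed

lemma sets_add_point[simp]: "sets (add_point \<eta> x) = sets \<eta>"
  and space_add_point[simp]: "space (add_point \<eta> x) = space \<eta>"
  by (simp_all add: add_point_def)

lemma sets_remove_point[simp]: "sets (remove_point \<eta> x) = sets \<eta>"
  and space_remove_point[simp]: "space (remove_point \<eta> x) = space \<eta>"
  by (simp_all add: remove_point_def)

lemma emeasure_add_point:
  assumes C: "C \<in> sets \<eta>"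
  shows "emeasure (add_point \<eta> x) C = emeasure \<eta> C + indicator C x"
proof -
  have "emeasure (add_point \<eta> x) C = emeasure \<eta> C + emeasure (return \<eta> x) C"
    unfolding add_point_def
  proof (rule emeasure_measure_of_sigma)
    show "countably_additive (sets \<eta>) (\<lambda>B. emeasure \<eta> B + emeasure (return \<eta> x) B)"
    proof (rule countably_additiveI)
      fix A :: "nat \<Rightarrow> 'a set"
      assume A: "range A \<subseteq> sets \<eta>" "disjoint_family A" "\<Union>(range A) \<in> sets \<eta>"
      have "(\<Sum>i. emeasure \<eta> (A i) + emeasure (return \<eta> x) (A i)) =
          (\<Sum>i. emeasure \<eta> (A i)) + (\<Sum>i. emeasure (return \<eta> x) (A i))"
        by (rule suminf_add[symmetric]) auto
      also have "\<dots> = emeasure \<eta> (\<Union>(range A)) + emeasure (return \<eta> x) (\<Union>(range A))"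
        using A by (intro arg_cong2[where f="(+)"] suminf_emeasure) auto
      finally show "(\<Sum>i. emeasure \<eta> (A i) + emeasure (return \<eta> x) (A i)) =
          emeasure \<eta> (\<Union>(range A)) + emeasure (return \<eta> x) (\<Union>(range A))" .
    qed
  qed (use C in \<open>auto simp: positive_def sets.sigma_algebra_axioms\<close>)
  then show ?thesis
    using C by simp
qed

lemma dominates_dirac_iff:
  assumes "{x} \<in> sets \<eta>"
  shows "(\<forall>C\<in>sets \<eta>. emeasure (return \<eta> x) C \<le> emeasure \<eta> C) \<longleftrightarrow> 1 \<le> emeasure \<eta> {x}"
proof safe
  assume "\<forall>C\<in>sets \<eta>. emeasure (return \<eta> x) C \<le> emeasure \<eta> C"
  from this[rule_format, OF assms] show "1 \<le> emeasure \<eta> {x}"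
    using assms by simp
next
  fix C assume le: "1 \<le> emeasure \<eta> {x}" and C: "C \<in> sets \<eta>"
  then have "1 \<le> emeasure \<eta> C" if "x \<in> C"
    using that by (intro order_trans[OF le] emeasure_mono) auto
  then show "emeasure (return \<eta> x) C \<le> emeasure \<eta> C"
    using C by (auto simp: indicator_def)
qed

text \<open>
  The difference of the two set functions is a measure although \<open>\<eta>\<close> may be infinite,
  because the subtracted Dirac mass is finite and can be cancelled from
  \<open>(\<eta> - \<delta>\<^sub>x) + \<delta>\<^sub>x = \<eta>\<close>, summed over the disjoint pieces.
\<close>
lemma emeasure_remove_point:
  assumes x: "{x} \<in> sets \<eta>" and C: "C \<in> sets \<eta>"
  shows "emeasure (remove_point \<eta> x) C =
    (if 1 \<le> emeasure \<eta> {x} then emeasure \<eta> C - indicator C x else emeasure \<eta> C)"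
proof (cases "1 \<le> emeasure \<eta> {x}")
  case True
  let ?\<nu> = "\<lambda>C. emeasure \<eta> C - emeasure (return \<eta> x) C"
  have le: "emeasure (return \<eta> x) D \<le> emeasure \<eta> D" if "D \<in> sets \<eta>" for D
    using True that dominates_dirac_iff[OF x] by auto
  have "emeasure (remove_point \<eta> x) C = ?\<nu> C"
    unfolding remove_point_def dominates_dirac_iff[OF x] if_P[OF True] diff_measure_def
  proof (rule emeasure_measure_of_sigma)
    show "countably_additive (sets \<eta>) ?\<nu>"
    proof (rule countably_additiveI)
      fix A :: "nat \<Rightarrow> 'a set"
      assume A: "range A \<subseteq> sets \<eta>" "disjoint_family A" "\<Union>(range A) \<in> sets \<eta>"
      have "(\<Sum>i. ?\<nu> (A i)) + emeasure (return \<eta> x) (\<Union>(range A)) =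
          (\<Sum>i. ?\<nu> (A i)) + (\<Sum>i. emeasure (return \<eta> x) (A i))"
        using A by (intro arg_cong2[where f="(+)"] refl suminf_emeasure[symmetric]) auto
      also have "\<dots> = (\<Sum>i. ?\<nu> (A i) + emeasure (return \<eta> x) (A i))"
        by (rule suminf_add) auto
      also have "\<dots> = (\<Sum>i. emeasure \<eta> (A i))"
        using A le by (intro suminf_cong) (auto intro!: diff_add_cancel_ennreal)
      also have "\<dots> = emeasure \<eta> (\<Union>(range A))"
        using A by (intro suminf_emeasure) auto
      finally have "(\<Sum>i. ?\<nu> (A i)) + emeasure (return \<eta> x) (\<Union>(range A)) =
          emeasure \<eta> (\<Union>(range A))" .
      moreover have "emeasure (return \<eta> x) (\<Union>(range A)) \<noteq> \<top>"
        using A(3) by (subst emeasure_return) (auto simp: indicator_def)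
      ultimately show "(\<Sum>i. ?\<nu> (A i)) = ?\<nu> (\<Union>(range A))"
        by (metis ennreal_add_diff_cancel_right)
    qed
  qed (use C in \<open>auto simp: positive_def sets.sigma_algebra_axioms\<close>)
  then show ?thesis
    using C True by simp
next
  case False
  then have "remove_point \<eta> x = \<eta>"
    using dominates_dirac_iff[OF x] unfolding remove_point_def by (intro if_not_P) simp
  with False show ?thesis by simp
qed

lemma add_point_counting_measure:
  assumes \<eta>: "\<eta> \<in> counting_measures M"
  shows "add_point \<eta> x \<in> counting_measures M"
proof -
  note sets = sets_counting_measure[OF \<eta>]
  interpret \<eta>: sigma_finite_measure \<eta>
    using \<eta> by (simp add: counting_measures_def)
  obtain A where A: "countable A" "A \<subseteq> sets \<eta>" "\<Union>A = space \<eta>" "\<forall>a\<in>A. emeasure \<eta> a \<noteq> \<infinity>"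
    using \<eta>.sigma_finite_countable by auto
  have "sigma_finite_measure (add_point \<eta> x)"
    using A by (intro sigma_finite_measure.intro exI[of _ A])
      (auto simp: emeasure_add_point subset_eq indicator_def)
  moreover have "emeasure \<eta> C + indicator C x \<in> insert \<infinity> (range of_nat)" if "C \<in> sets M" for C
  proof -
    have "emeasure \<eta> C \<in> insert \<infinity> (range of_nat)"
      using \<eta> that by (auto simp: counting_measures_def)
    then consider "emeasure \<eta> C = \<infinity>" | k where "emeasure \<eta> C = of_nat k"
      by auto
    then show ?thesis
    proof cases
      case (2 k)
      then have "emeasure \<eta> C + indicator C x = of_nat (k + indicator C x)"
        by (simp add: indicator_def)
      then show ?thesis by (metis insertI2 rangeI)
    qed simp
  qed
  ultimately show ?thesis
    using sets by (auto simp: counting_measures_def emeasure_add_point)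
qed

lemma remove_point_counting_measure:
  assumes \<eta>: "\<eta> \<in> counting_measures M" and x: "{x} \<in> sets M"
  shows "remove_point \<eta> x \<in> counting_measures M"
proof (cases "1 \<le> emeasure \<eta> {x}")
  case True
  note sets = sets_counting_measure[OF \<eta>]
  interpret \<eta>: sigma_finite_measure \<eta>
    using \<eta> by (simp add: counting_measures_def)
  obtain A where A: "countable A" "A \<subseteq> sets \<eta>" "\<Union>A = space \<eta>" "\<forall>a\<in>A. emeasure \<eta> a \<noteq> \<infinity>"
    using \<eta>.sigma_finite_countable by auto
  have "sigma_finite_measure (remove_point \<eta> x)"
    using A x sets by (intro sigma_finite_measure.intro exI[of _ A])
      (auto simp: emeasure_remove_point subset_eq indicator_def)
  moreover have "emeasure (remove_point \<eta> x) C \<in> insert \<infinity> (range of_nat)" if "C \<in> sets M" for C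
  proof -
    have "emeasure \<eta> C \<in> insert \<infinity> (range of_nat)"
      using \<eta> that by (auto simp: counting_measures_def)
    then consider "emeasure \<eta> C = \<infinity>" | k where "emeasure \<eta> C = of_nat k"
      by auto
    then show ?thesis
    proof cases
      case 1
      then show ?thesis
        using x sets that True by (simp add: emeasure_remove_point indicator_def)
    next
      case (2 k)
      have "emeasure (remove_point \<eta> x) C = ennreal (real k) - ennreal (indicator C x)"
        using x sets that True 2 by (simp add: emeasure_remove_point indicator_def ennreal_of_nat_eq_real_of_nat)
      also have "\<dots> = of_nat (k - indicator C x)"
        by (cases k) (auto simp: indicator_def ennreal_minus ennreal_of_nat_eq_real_of_nat
            simp flip: ennreal_1)
      finally show ?thesis by (metis insertI2 rangeI)
    qed
  qed
  ultimately show ?thesis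
    using sets by (auto simp: counting_measures_def)
next
  case False
  then have "remove_point \<eta> x = \<eta>"
    using dominates_dirac_iff[of x \<eta>] x sets_counting_measure[OF \<eta>]
    unfolding remove_point_def by (intro if_not_P) simp
  with \<eta> show ?thesis by simp
qed

lemma remove_add_point:
  assumes x: "{x} \<in> sets \<eta>"
  shows "remove_point (add_point \<eta> x) x = \<eta>"
  by (rule measure_eqI) (use x in \<open>auto simp: emeasure_remove_point emeasure_add_point
      add_increasing ennreal_add_diff_cancel_right indicator_def\<close>)

text \<open>
  Without an atom of \<open>\<eta>\<close> at \<open>y\<close> this fails for \<open>y = x\<close>: the left side is then \<open>\<eta>\<close>
  and the right side \<open>\<eta> + \<delta>\<^sub>x\<close>.
\<close>
lemma remove_add_point_commute:
  assumes y: "{y} \<in> sets \<eta>" and ge: "1 \<le> emeasure \<eta> {y}"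
  shows "remove_point (add_point \<eta> x) y = add_point (remove_point \<eta> y) x"
proof (rule measure_eqI)
  fix C assume "C \<in> sets (remove_point (add_point \<eta> x) y)"
  then have C: "C \<in> sets \<eta>" by simp
  have 1: "1 \<le> emeasure (add_point \<eta> x) {y}"
    using ge y by (simp add: emeasure_add_point add_increasing2)
  have "1 \<le> emeasure \<eta> C" if "y \<in> C"
    using that C by (intro order_trans[OF ge] emeasure_mono) auto
  then have "emeasure \<eta> C + indicator C x - indicator C y = emeasure \<eta> C - indicator C y + (indicator C x :: ennreal)"
    by (auto simp: indicator_def add_diff_eq_ennreal add.commute)
  then show "emeasure (remove_point (add_point \<eta> x) y) C = emeasure (add_point (remove_point \<eta> y) x) C"
    using C y ge 1 by (simp add: emeasure_remove_point emeasure_add_point)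
qed simp

lemma nn_integral_add_point:
  assumes g: "g \<in> borel_measurable \<eta>" and x: "x \<in> space \<eta>"
  shows "(\<integral>\<^sup>+y. g y \<partial>add_point \<eta> x) = (\<integral>\<^sup>+y. g y \<partial>\<eta>) + g x"
  using g
proof (induction rule: borel_measurable_induct)
  case (cong f g)
  have "integral\<^sup>N (add_point \<eta> x) f = integral\<^sup>N (add_point \<eta> x) g"
    "integral\<^sup>N \<eta> f = integral\<^sup>N \<eta> g"
    using cong(3) by (auto intro!: nn_integral_cong)
  with cong(3)[OF x] cong(4) show ?case by simp
next
  case (set A)
  then show ?case by (simp add: emeasure_add_point)
next
  case (mult u c)
  then show ?case
    by (simp add: nn_integral_cmult measurable_cong_sets[OF sets_add_point refl] distrib_left)
next
  case (add u v)
  then show ?case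
    by (simp add: nn_integral_add measurable_cong_sets[OF sets_add_point refl] ac_simps)
next
  case (seq U)
  have [measurable]: "U i \<in> borel_measurable (add_point \<eta> x)" for i
    using seq by (simp add: measurable_cong_sets[OF sets_add_point refl])
  have "(SUP i. (\<integral>\<^sup>+y. U i y \<partial>\<eta>) + U i x) = (SUP i. \<integral>\<^sup>+y. U i y \<partial>\<eta>) + (SUP i. U i x)"
    using seq by (intro ennreal_SUP_add) (auto simp: incseq_def le_fun_def intro!: nn_integral_mono)
  then show ?case
    using seq by (simp add: nn_integral_monotone_convergence_SUP image_comp)
qed

lemma integrable_add_point:
  fixes g :: "'e \<Rightarrow> 'h::{banach, second_countable_topology}"
  assumes g: "integrable \<eta> g" and x: "x \<in> space \<eta>"
  shows "integrable (add_point \<eta> x) g"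
  using g x by (auto simp: integrable_iff_bounded measurable_cong_sets[OF sets_add_point refl]
      nn_integral_add_point)

lemma integral_add_point:
  fixes g :: "'e \<Rightarrow> 'h::{banach, second_countable_topology}"
  assumes g: "integrable \<eta> g" and x: "x \<in> space \<eta>"
  shows "(\<integral>y. g y \<partial>add_point \<eta> x) = (\<integral>y. g y \<partial>\<eta>) + g x"
  using g
proof (induction rule: integrable_induct)
  case (base A c)
  then have "measure (add_point \<eta> x) A = measure \<eta> A + indicator A x"
    by (simp add: measure_def emeasure_add_point indicator_def enn2real_plus)
  moreover have "(\<integral>y. indicator A y *\<^sub>R c \<partial>add_point \<eta> x) = measure (add_point \<eta> x) A *\<^sub>R c"
    using base by (intro has_bochner_integral_integral_eq has_bochner_integral_indicator)
      (auto simp: emeasure_add_point indicator_def)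
  moreover have "(\<integral>y. indicator A y *\<^sub>R c \<partial>\<eta>) = measure \<eta> A *\<^sub>R c"
    using base by (intro has_bochner_integral_integral_eq has_bochner_integral_indicator) auto
  ultimately show ?case
    by (simp add: scaleR_left_distrib)
next
  case (add f g)
  then show ?case
    using x by (simp add: integrable_add_point)
next
  case (lim f s)
  note [measurable_cong] = sets_add_point
  have [measurable]: "f \<in> borel_measurable \<eta>" "\<And>i. s i \<in> borel_measurable \<eta>"
    using lim by auto
  have "(\<lambda>i. \<integral>y. s i y \<partial>add_point \<eta> x) \<longlonglongrightarrow> (\<integral>y. f y \<partial>add_point \<eta> x)"
    by (rule integral_dominated_convergence[where w="\<lambda>y. 2 * norm (f y)"])
      (use lim x in \<open>auto intro!: integrable_add_point\<close>)
  moreover have "(\<lambda>i. \<integral>y. s i y \<partial>\<eta>) \<longlonglongrightarrow> (\<integral>y. f y \<partial>\<eta>)"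
    by (rule integral_dominated_convergence[where w="\<lambda>y. 2 * norm (f y)"])
      (use lim x in auto)
  then have "(\<lambda>i. (\<integral>y. s i y \<partial>\<eta>) + s i x) \<longlonglongrightarrow> (\<integral>y. f y \<partial>\<eta>) + f x"
    using lim x by (intro tendsto_add) auto
  ultimately show ?case
    using lim by (auto intro: LIMSEQ_unique)
qed

lemma measurable_add_point:
  "(\<lambda>(\<eta>, x). add_point \<eta> x) \<in> measurable (counting_algebra M \<Otimes>\<^sub>M M) (counting_algebra M)"
proof (rule measurable_counting_algebra)
  fix C assume [measurable]: "C \<in> sets M"
  show "(\<lambda>z. emeasure (case z of (\<eta>, x) \<Rightarrow> add_point \<eta> x) C)
      \<in> borel_measurable (counting_algebra M \<Otimes>\<^sub>M M)"
    by (subst measurable_cong[where g="\<lambda>z. emeasure (fst z) C + indicator C (snd z)"])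
      (auto simp: space_pair_measure space_counting_algebra emeasure_add_point sets_counting_measure)
qed (auto simp: space_pair_measure space_counting_algebra add_point_counting_measure)

section \<open>Measures that are finite on an exhausting sequence\<close>

locale exhausted_space =
  fixes M :: "'e measure" and B :: "nat \<Rightarrow> 'e set"
  assumes diagonal: "measurable_diagonal M"
    and B_sets[measurable]: "\<And>n. B n \<in> sets M"
    and B_incseq: "incseq B"
    and B_exhausts: "(\<Union>n. B n) = space M"
begin

text \<open>
  The counting measures that are finite on every \<open>B n\<close>. Almost every realization of the
  point process is one of them, and on them the mass \<open>\<eta> {y}\<close> of a point, and with it
  \<open>\<eta> \ \<delta>\<^sub>y\<close>, is jointly measurable in \<open>\<eta>\<close> and \<open>y\<close>.
\<close>
definition lf_algebra :: "'e measure measure" where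
  "lf_algebra = restrict_space (counting_algebra M) {\<eta>. \<forall>n. emeasure \<eta> (B n) < \<infinity>}"

lemma space_lf_algebra:
  "space lf_algebra = {\<eta>\<in>counting_measures M. \<forall>n. emeasure \<eta> (B n) < \<infinity>}"
  by (auto simp: lf_algebra_def space_restrict_space space_counting_algebra)

lemma sets_lf: "\<eta> \<in> space lf_algebra \<Longrightarrow> sets \<eta> = sets M"
  by (simp add: space_lf_algebra sets_counting_measure)

lemma space_lf: "\<eta> \<in> space lf_algebra \<Longrightarrow> space \<eta> = space M"
  by (simp add: space_lf_algebra space_counting_measure)

lemma singleton_sets: "x \<in> space M \<Longrightarrow> {x} \<in> sets M"
  by (rule measurable_diagonal_singleton[OF diagonal])

lemma lf_algebra_embedding[measurable]: "(\<lambda>\<eta>. \<eta>) \<in> measurable lf_algebra (counting_algebra M)"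
  unfolding lf_algebra_def by (rule measurable_restrict_space1) simp

lemma measurable_lf_algebra:
  assumes "\<And>z. z \<in> space L \<Longrightarrow> \<kappa> z \<in> space lf_algebra"
    and "\<And>C. C \<in> sets M \<Longrightarrow> (\<lambda>z. emeasure (\<kappa> z) C) \<in> borel_measurable L"
  shows "\<kappa> \<in> measurable L lf_algebra"
  unfolding lf_algebra_def using assms
  by (intro measurable_restrict_space2 measurable_counting_algebra) (auto simp: space_lf_algebra)

lemma measurable_emeasure_lf[measurable]:
  "C \<in> sets M \<Longrightarrow> (\<lambda>\<eta>. emeasure \<eta> C) \<in> borel_measurable lf_algebra"
  by (rule measurable_compose[OF lf_algebra_embedding measurable_emeasure_counting_algebra])

lemma lf_kernel:
  assumes \<kappa>[measurable]: "\<kappa> \<in> measurable L lf_algebra"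
  shows "finite_on_exhaustion_kernel L M B \<kappa>"
proof
  fix z assume "z \<in> space L"
  then have "\<kappa> z \<in> space lf_algebra"
    using \<kappa> by (rule measurable_space[rotated])
  then show "sets (\<kappa> z) = sets M" "\<And>n. emeasure (\<kappa> z) (B n) < \<infinity>"
    by (auto simp: space_lf_algebra sets_counting_measure)
next
  fix C assume [measurable]: "C \<in> sets M"
  show "(\<lambda>z. emeasure (\<kappa> z) C) \<in> borel_measurable L"
    by measurable
qed (use B_incseq B_exhausts in auto)

lemmas borel_measurable_nn_integral_lf =
    finite_on_exhaustion_kernel.borel_measurable_nn_integral_kernel[OF lf_kernel]
  and borel_measurable_integral_lf =
    finite_on_exhaustion_kernel.borel_measurable_integral_kernel[OF lf_kernel]

text \<open>
  The mass at \<open>y\<close> is the integral of the indicator of the diagonal at \<open>(y, \<cdot>)\<close>, so joint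
  measurability follows from that of the diagonal.
\<close>
lemma measurable_mass_at_point[measurable]:
  "(\<lambda>(\<eta>, y). emeasure \<eta> {y}) \<in> borel_measurable (lf_algebra \<Otimes>\<^sub>M M)"
proof -
  let ?D = "{(x, y). x \<in> space M \<and> y \<in> space M \<and> x = y}"
  have D[measurable]: "?D \<in> sets (M \<Otimes>\<^sub>M M)"
    using diagonal by (simp add: measurable_diagonal_def)
  have "(\<lambda>z. \<integral>\<^sup>+u. indicator ?D (snd (fst (z, u)), snd (z, u)) \<partial>fst z)
      \<in> borel_measurable (lf_algebra \<Otimes>\<^sub>M M)"
    by (rule borel_measurable_nn_integral_lf) measurable
  also have "?this \<longleftrightarrow> ?thesis"
  proof (rule measurable_cong)
    fix z assume "z \<in> space (lf_algebra \<Otimes>\<^sub>M M)"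
    then obtain \<eta> y where z: "z = (\<eta>, y)" "\<eta> \<in> space lf_algebra" "y \<in> space M"
      by (auto simp: space_pair_measure)
    have "(\<integral>\<^sup>+u. indicator ?D (y, u) \<partial>\<eta>) = (\<integral>\<^sup>+u. indicator {y} u \<partial>\<eta>)"
      using z by (intro nn_integral_cong) (auto simp: indicator_def space_lf)
    then show "(\<integral>\<^sup>+u. indicator ?D (snd (fst (z, u)), snd (z, u)) \<partial>fst z) =
        (case z of (\<eta>, y) \<Rightarrow> emeasure \<eta> {y})"
      using z singleton_sets[of y] by (simp add: sets_lf)
  qed
  finally show ?thesis .
qed

lemma measurable_add_point_lf[measurable]:
  "(\<lambda>(\<eta>, x). add_point \<eta> x) \<in> measurable (lf_algebra \<Otimes>\<^sub>M M) lf_algebra"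
proof (rule measurable_lf_algebra)
  fix C assume [measurable]: "C \<in> sets M"
  show "(\<lambda>z. emeasure (case z of (\<eta>, x) \<Rightarrow> add_point \<eta> x) C)
      \<in> borel_measurable (lf_algebra \<Otimes>\<^sub>M M)"
    by (subst measurable_cong[where g="\<lambda>z. emeasure (fst z) C + indicator C (snd z)"])
      (auto simp: space_pair_measure emeasure_add_point sets_lf)
qed (auto simp: space_pair_measure space_lf_algebra add_point_counting_measure
    emeasure_add_point sets_counting_measure indicator_def)

lemma measurable_remove_point_lf[measurable]:
  "(\<lambda>(\<eta>, x). remove_point \<eta> x) \<in> measurable (lf_algebra \<Otimes>\<^sub>M M) lf_algebra"
proof (rule measurable_lf_algebra)
  fix C assume [measurable]: "C \<in> sets M"
  show "(\<lambda>z. emeasure (case z of (\<eta>, x) \<Rightarrow> remove_point \<eta> x) C)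
      \<in> borel_measurable (lf_algebra \<Otimes>\<^sub>M M)"
    by (subst measurable_cong[where g="\<lambda>z. if 1 \<le> (\<lambda>(\<eta>, y). emeasure \<eta> {y}) z
          then emeasure (fst z) C - indicator C (snd z) else emeasure (fst z) C"])
      (auto simp: space_pair_measure emeasure_remove_point sets_lf singleton_sets)
next
  fix z assume "z \<in> space (lf_algebra \<Otimes>\<^sub>M M)"
  then show "(case z of (\<eta>, x) \<Rightarrow> remove_point \<eta> x) \<in> space lf_algebra"
    using singleton_sets
    by (auto simp: space_pair_measure space_lf_algebra remove_point_counting_measure less_top[symmetric]
      emeasure_remove_point sets_counting_measure ennreal_minus_eq_top split: if_splits)
qed

end

section \<open>Size biasing of independent Poisson variables\<close>

context prob_space
begin

lemma poisson_AE_nat: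
  fixes h :: "'a \<Rightarrow> ennreal"
  assumes [measurable]: "h \<in> borel_measurable M"
    and h: "\<And>k::nat. prob {\<omega>\<in>space M. h \<omega> = of_nat k} = l ^ k / fact k * exp (- l)"
  shows "AE \<omega> in M. \<exists>k::nat. h \<omega> = of_nat k"
proof -
  let ?A = "\<lambda>k::nat. {\<omega>\<in>space M. h \<omega> = of_nat k}"
  have "(\<lambda>k. prob (?A k)) sums prob (\<Union>k. ?A k)"
    by (rule finite_measure_UNION) (auto simp: disjoint_family_on_def)
  moreover have "(\<lambda>k. l ^ k / fact k * exp (- l)) sums (exp l * exp (- l))"
    using exp_converges[of l] by (intro sums_mult2) (simp add: field_simps)
  ultimately have "prob (\<Union>k. ?A k) = 1"
    by (simp add: h exp_minus sums_unique2)
  from AE_prob_1[OF this] show ?thesis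
    by eventually_elim auto
qed

lemma nn_integral_poisson:
  fixes h :: "'a \<Rightarrow> ennreal"
  assumes [measurable]: "h \<in> borel_measurable M" "g \<in> borel_measurable borel"
    and h: "\<And>k::nat. prob {\<omega>\<in>space M. h \<omega> = of_nat k} = l ^ k / fact k * exp (- l)"
  shows "(\<integral>\<^sup>+\<omega>. g (h \<omega>) \<partial>M) = (\<Sum>k. g (of_nat k) * ennreal (l ^ k / fact k * exp (- l)))"
proof -
  let ?A = "\<lambda>k::nat. {\<omega>\<in>space M. h \<omega> = of_nat k}"
  have "(\<integral>\<^sup>+\<omega>. g (h \<omega>) \<partial>M) = (\<integral>\<^sup>+\<omega>. (\<Sum>k. g (of_nat k) * indicator (?A k) \<omega>) \<partial>M)"
  proof (rule nn_integral_cong_AE)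
    have "AE \<omega> in M. \<exists>k::nat. h \<omega> = of_nat k"
      by (rule poisson_AE_nat[OF _ h]) measurable
    then show "AE \<omega> in M. g (h \<omega>) = (\<Sum>k. g (of_nat k) * indicator (?A k) \<omega>)"
      using AE_space
    proof eventually_elim
      fix \<omega> assume \<omega>: "\<exists>k::nat. h \<omega> = of_nat k" "\<omega> \<in> space M"
      then obtain i :: nat where i: "h \<omega> = of_nat i" by auto
      have "(\<lambda>k. g (of_nat k) * indicator (?A k) \<omega>) = (\<lambda>k. if k = i then g (of_nat k) else 0)"
        using i \<omega> by (auto simp: indicator_def fun_eq_iff)
      then show "g (h \<omega>) = (\<Sum>k. g (of_nat k) * indicator (?A k) \<omega>)"
        using sums_unique[OF sums_single[of i "\<lambda>k. g (of_nat k)"]] by (simp add: i)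
    qed
  qed
  also have "\<dots> = (\<Sum>k. \<integral>\<^sup>+\<omega>. g (of_nat k) * indicator (?A k) \<omega> \<partial>M)"
    by (rule nn_integral_suminf) measurable
  also have "\<dots> = (\<Sum>k. g (of_nat k) * ennreal (l ^ k / fact k * exp (- l)))"
    by (subst nn_integral_cmult_indicator) (auto simp: emeasure_eq_measure h)
  finally show ?thesis .
qed

text \<open>
  The identity \<open>(k + 1) p(k + 1) = l p(k)\<close> for the Poisson weights, integrated. It is the
  Mecke equation for a process on a one-point space.
\<close>
lemma poisson_size_bias:
  fixes h :: "'a \<Rightarrow> ennreal"
  assumes [measurable]: "h \<in> borel_measurable M" "q \<in> borel_measurable borel"
    and l: "0 \<le> l"
    and h: "\<And>k::nat. prob {\<omega>\<in>space M. h \<omega> = of_nat k} = l ^ k / fact k * exp (- l)"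
  shows "(\<integral>\<^sup>+\<omega>. h \<omega> * q (h \<omega>) \<partial>M) = ennreal l * (\<integral>\<^sup>+\<omega>. q (h \<omega> + 1) \<partial>M)"
proof -
  let ?p = "\<lambda>k::nat. l ^ k / fact k * exp (- l)"
  have p: "ennreal (?p (Suc k)) * of_nat (Suc k) = ennreal l * ennreal (?p k)" for k
    using l by (simp add: ennreal_of_nat_eq_real_of_nat ennreal_mult[symmetric] field_simps
        del: of_nat_Suc)
  have "(\<integral>\<^sup>+\<omega>. h \<omega> * q (h \<omega>) \<partial>M) = (\<Sum>k. of_nat k * q (of_nat k) * ennreal (?p k))"
    by (rule nn_integral_poisson[where g="\<lambda>t. t * q t"]) (auto simp: h)
  also have "\<dots> = (\<Sum>k. of_nat (Suc k) * q (of_nat (Suc k)) * ennreal (?p (Suc k)))"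
    by (subst suminf_offset[where i=1]) (auto simp del: of_nat_Suc)
  also have "\<dots> = (\<Sum>k. ennreal l * (q (of_nat k + 1) * ennreal (?p k)))"
  proof (rule suminf_cong)
    fix k
    have "of_nat (Suc k) * q (of_nat (Suc k)) * ennreal (?p (Suc k)) =
        q (of_nat (Suc k)) * (ennreal (?p (Suc k)) * of_nat (Suc k))"
      by (simp only: ac_simps)
    also have "\<dots> = ennreal l * (q (of_nat k + 1) * ennreal (?p k))"
      unfolding p by (simp add: ac_simps)
    finally show "of_nat (Suc k) * q (of_nat (Suc k)) * ennreal (?p (Suc k)) =
        ennreal l * (q (of_nat k + 1) * ennreal (?p k))" .
  qed
  also have "\<dots> = ennreal l * (\<integral>\<^sup>+\<omega>. q (h \<omega> + 1) \<partial>M)"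
    by (subst nn_integral_poisson[where g="\<lambda>t. q (t + 1)" and h=h, OF _ _ h])
      (auto simp: ennreal_suminf_cmult)
  finally show ?thesis .
qed

text \<open>
  The Mecke equation for a finite space \<open>I\<close>: by independence the variables other than
  \<open>h j\<close> can be frozen, which leaves the one-dimensional identity.
\<close>
lemma independent_poisson_size_bias:
  fixes h :: "nat \<Rightarrow> 'a \<Rightarrow> ennreal" and I :: "nat set"
  assumes indep: "indep_vars (\<lambda>_. borel) h I"
    and j: "j \<in> I" and l: "0 \<le> l"
    and h: "\<And>k::nat. prob {\<omega>\<in>space M. h j \<omega> = of_nat k} = l ^ k / fact k * exp (- l)"
    and g[measurable]: "g \<in> borel_measurable (Pi\<^sub>M I (\<lambda>_. borel))"
  shows "(\<integral>\<^sup>+\<omega>. h j \<omega> * g (\<lambda>i\<in>I. h i \<omega>) \<partial>M) =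
    ennreal l * (\<integral>\<^sup>+\<omega>. g (\<lambda>i\<in>I. if i = j then h j \<omega> + 1 else h i \<omega>) \<partial>M)"
proof -
  let ?S = "Pi\<^sub>M {j} (\<lambda>_. borel :: ennreal measure)" and ?T = "Pi\<^sub>M (I - {j}) (\<lambda>_. borel :: ennreal measure)"
  let ?U = "\<lambda>\<omega>. \<lambda>i\<in>{j}. h i \<omega>" and ?V = "\<lambda>\<omega>. \<lambda>i\<in>I-{j}. h i \<omega>"
  have hm[measurable]: "i \<in> I \<Longrightarrow> h i \<in> borel_measurable M" for i
    using indep by (auto simp: indep_vars_def)
  have "indep_var ?S ?U ?T ?V"
    using j by (intro indep_var_restrict[OF indep]) auto
  then have eq: "distr M ?S ?U \<Otimes>\<^sub>M distr M ?T ?V = distr M (?S \<Otimes>\<^sub>M ?T) (\<lambda>\<omega>. (?U \<omega>, ?V \<omega>))"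
    and [measurable]: "?U \<in> measurable M ?S" "?V \<in> measurable M ?T"
    by (auto simp: indep_var_distribution_eq)
  interpret U: prob_space "distr M ?S ?U" by (rule prob_space_distr) measurable
  interpret V: prob_space "distr M ?T ?V" by (rule prob_space_distr) measurable
  interpret UV: pair_sigma_finite "distr M ?S ?U" "distr M ?T ?V" ..
  \<comment> \<open>Independence, used as a decoupling of the \<open>j\<close>-th coordinate from the others.\<close>
  have split: "(\<integral>\<^sup>+\<omega>. G (?U \<omega>, ?V \<omega>) \<partial>M) = (\<integral>\<^sup>+\<omega>'. \<integral>\<^sup>+\<omega>. G (?U \<omega>, ?V \<omega>') \<partial>M \<partial>M)"
    if G[measurable]: "G \<in> borel_measurable (?S \<Otimes>\<^sub>M ?T)" for G
  proof -
    have "(\<integral>\<^sup>+\<omega>. G (?U \<omega>, ?V \<omega>) \<partial>M) = integral\<^sup>N (distr M ?S ?U \<Otimes>\<^sub>M distr M ?T ?V) G"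
      unfolding eq by (subst nn_integral_distr) measurable
    also have "\<dots> = (\<integral>\<^sup>+v. \<integral>\<^sup>+u. G (u, v) \<partial>distr M ?S ?U \<partial>distr M ?T ?V)"
      by (rule UV.nn_integral_snd[symmetric]) (simp cong: measurable_cong_sets)
    also have "\<dots> = (\<integral>\<^sup>+v. \<integral>\<^sup>+\<omega>. G (?U \<omega>, v) \<partial>M \<partial>distr M ?T ?V)"
      by (intro nn_integral_cong nn_integral_distr) (auto simp: space_PiM)
    also have "\<dots> = (\<integral>\<^sup>+\<omega>'. \<integral>\<^sup>+\<omega>. G (?U \<omega>, ?V \<omega>') \<partial>M \<partial>M)"
      by (rule nn_integral_distr) measurable
    finally show ?thesis .
  qed
  define ins where "ins p = (\<lambda>i\<in>I. if i = j then fst p else snd p i)" for p :: "ennreal \<times> (nat \<Rightarrow> ennreal)"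
  have ins[measurable]: "ins \<in> measurable (borel \<Otimes>\<^sub>M ?T) (Pi\<^sub>M I (\<lambda>_. borel))"
    unfolding ins_def
  proof (rule measurable_restrict)
    fix i assume "i \<in> I"
    then show "(\<lambda>p. if i = j then fst p else snd p i) \<in> borel_measurable (borel \<Otimes>\<^sub>M ?T)"
      by (cases "i = j") (auto intro!: measurable_compose[OF measurable_snd measurable_component_singleton])
  qed
  have [measurable]: "(\<lambda>u. u j) \<in> borel_measurable ?S"
    by (rule measurable_component_singleton) simp
  have ins_eq: "(\<lambda>i\<in>I. h i \<omega>) = ins (?U \<omega> j, ?V \<omega>)"
    "(\<lambda>i\<in>I. if i = j then h j \<omega> + 1 else h i \<omega>) = ins (?U \<omega> j + 1, ?V \<omega>)" for \<omega>
    by (auto simp: ins_def fun_eq_iff)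
  have "(\<integral>\<^sup>+\<omega>. h j \<omega> * g (\<lambda>i\<in>I. h i \<omega>) \<partial>M) =
      (\<integral>\<^sup>+\<omega>. (\<lambda>(u, v). u j * g (ins (u j, v))) (?U \<omega>, ?V \<omega>) \<partial>M)"
    unfolding ins_eq by simp
  also have "\<dots> = (\<integral>\<^sup>+\<omega>'. \<integral>\<^sup>+\<omega>. (\<lambda>(u, v). u j * g (ins (u j, v))) (?U \<omega>, ?V \<omega>') \<partial>M \<partial>M)"
    by (rule split) measurable
  also have "\<dots> = (\<integral>\<^sup>+\<omega>'. \<integral>\<^sup>+\<omega>. h j \<omega> * g (ins (h j \<omega>, ?V \<omega>')) \<partial>M \<partial>M)"
    by simp
  also have "\<dots> = (\<integral>\<^sup>+\<omega>'. ennreal l * (\<integral>\<^sup>+\<omega>. g (ins (h j \<omega> + 1, ?V \<omega>')) \<partial>M) \<partial>M)"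
  proof (rule nn_integral_cong)
    fix \<omega>' assume "\<omega>' \<in> space M"
    then have [measurable]: "?V \<omega>' \<in> space ?T"
      by (auto simp: space_PiM)
    show "(\<integral>\<^sup>+\<omega>. h j \<omega> * g (ins (h j \<omega>, ?V \<omega>')) \<partial>M) =
        ennreal l * (\<integral>\<^sup>+\<omega>. g (ins (h j \<omega> + 1, ?V \<omega>')) \<partial>M)"
      by (rule poisson_size_bias[OF _ _ l h, of "\<lambda>t. g (ins (t, ?V \<omega>'))"]) (use j in measurable)
  qed
  also have "\<dots> = ennreal l * (\<integral>\<^sup>+\<omega>'. \<integral>\<^sup>+\<omega>. (\<lambda>(u, v). g (ins (u j + 1, v))) (?U \<omega>, ?V \<omega>') \<partial>M \<partial>M)"
    using j by (subst nn_integral_cmult) auto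
  also have "(\<integral>\<^sup>+\<omega>'. \<integral>\<^sup>+\<omega>. (\<lambda>(u, v). g (ins (u j + 1, v))) (?U \<omega>, ?V \<omega>') \<partial>M \<partial>M) =
      (\<integral>\<^sup>+\<omega>. (\<lambda>(u, v). g (ins (u j + 1, v))) (?U \<omega>, ?V \<omega>) \<partial>M)"
    by (rule split[symmetric]) measurable
  also have "\<dots> = (\<integral>\<^sup>+\<omega>. g (\<lambda>i\<in>I. if i = j then h j \<omega> + 1 else h i \<omega>) \<partial>M)"
    unfolding ins_eq by simp
  finally show ?thesis .
qed

end

section \<open>Cylinder sets of counting measures\<close>

text \<open>
  The atoms are numbered by an enumeration \<open>e\<close> of the subfamilies of \<open>\<C>\<close>: the \<open>i\<close>-th atom
  consists of the points of \<open>D\<close> whose set of members of \<open>\<C>\<close> containing them is \<open>e i\<close>.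
  Natural numbers as indices match the form in which independence of the process is given.
\<close>
lemma atoms_of_finite_family:
  assumes fin: "finite \<C>" and sets: "\<C> \<subseteq> sets M" and D: "D \<in> sets M" and sub: "\<Union>\<C> \<subseteq> D"
  obtains A :: "nat \<Rightarrow> 'e set" and I :: "nat set" and S :: "'e set \<Rightarrow> nat set"
  where "finite I" "A ` I \<subseteq> sets M" "disjoint_family_on A I" "\<And>i. i \<in> I \<Longrightarrow> A i \<subseteq> D"
    "\<And>C. C \<in> \<C> \<Longrightarrow> S C \<subseteq> I" "\<And>C. C \<in> \<C> \<Longrightarrow> C = (\<Union>i\<in>S C. A i)"
    "\<And>C i x. C \<in> \<C> \<Longrightarrow> i \<in> I \<Longrightarrow> x \<in> A i \<Longrightarrow> x \<in> C \<longleftrightarrow> i \<in> S C"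
proof -
  obtain e where e: "bij_betw e {0..<card (Pow \<C>)} (Pow \<C>)"
    using ex_bij_betw_nat_finite[of "Pow \<C>"] fin by auto
  define I where "I = {0..<card (Pow \<C>)}"
  define A where "A i = {x\<in>D. \<forall>C\<in>\<C>. x \<in> C \<longleftrightarrow> C \<in> e i}" for i
  define S where "S C = {i\<in>I. C \<in> e i}" for C
  have e_Pow: "e i \<subseteq> \<C>" if "i \<in> I" for i
    using bij_betwE[OF e] that by (auto simp: I_def)
  show thesis
  proof (rule that[of I A S])
    have "A i = D \<inter> (\<Inter>C\<in>\<C>. if C \<in> e i then C \<inter> space M else space M - C) \<inter> space M" for i
      using sets.sets_into_space[OF D] by (auto simp: A_def split: if_splits)
    moreover have "D \<inter> (\<Inter>C\<in>\<C>. if C \<in> e i then C \<inter> space M else space M - C) \<inter> space M \<in> sets M" for i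
    proof (cases "\<C> = {}")
      case False
      then show ?thesis
        using fin sets D by (intro sets.Int sets.finite_INT) auto
    qed (use D in auto)
    ultimately show "A ` I \<subseteq> sets M" by auto
    show "disjoint_family_on A I"
      unfolding disjoint_family_on_def
    proof (intro ballI impI)
      fix m n assume mn: "m \<in> I" "n \<in> I" "m \<noteq> n"
      then have "e m \<noteq> e n"
        using e by (auto simp: bij_betw_def inj_on_def I_def)
      then obtain C where "C \<in> \<C>" "C \<in> e m \<longleftrightarrow> C \<notin> e n"
        using e_Pow[OF mn(1)] e_Pow[OF mn(2)] by blast
      then show "A m \<inter> A n = {}"
        by (auto simp: A_def)
    qed
    fix C assume C: "C \<in> \<C>"
    show mem: "x \<in> C \<longleftrightarrow> i \<in> S C" if "i \<in> I" "x \<in> A i" for i x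
      using that C by (auto simp: A_def S_def)
    have "x \<in> (\<Union>i\<in>S C. A i)" if x: "x \<in> C" for x
    proof -
      have "{C'\<in>\<C>. x \<in> C'} \<in> e ` I"
        using e by (auto simp: bij_betw_def I_def)
      then obtain i where i: "i \<in> I" "e i = {C'\<in>\<C>. x \<in> C'}" by auto
      have "x \<in> A i"
        using x C sub i by (auto simp: A_def)
      moreover have "i \<in> S C"
        using i x C by (auto simp: S_def)
      ultimately show ?thesis by auto
    qed
    then show "C = (\<Union>i\<in>S C. A i)"
      using mem by (auto simp: S_def)
  qed (auto simp: I_def A_def S_def)
qed

context exhausted_space
begin

definition cylinder :: "'e set set \<Rightarrow> ('e set \<Rightarrow> ennreal set) \<Rightarrow> 'e measure set" where
  "cylinder \<C> V = {\<eta>\<in>counting_measures M. \<forall>C\<in>\<C>. emeasure \<eta> C \<in> V C}"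

text \<open>
  All sets of a cylinder lie in one \<open>B n\<close>, so that only Poisson variables with finite mean
  are involved; continuity from below shows that these cylinders still generate everything.
\<close>
definition cylinders :: "'e measure set set" where
  "cylinders = {cylinder \<C> V | \<C> V. finite \<C> \<and> \<C> \<subseteq> sets M \<and> (\<exists>n. \<Union>\<C> \<subseteq> B n) \<and> range V \<subseteq> sets borel}"

lemma cylinders_subset: "cylinders \<subseteq> Pow (counting_measures M)"
  by (auto simp: cylinders_def cylinder_def)

lemma Int_stable_cylinders: "Int_stable cylinders"
proof (rule Int_stableI)
  fix G G' assume "G \<in> cylinders" "G' \<in> cylinders"
  then obtain \<C> V n \<C>' V' n' where G: "G = cylinder \<C> V" "finite \<C>" "\<C> \<subseteq> sets M" "\<Union>\<C> \<subseteq> B n" "range V \<subseteq> sets borel"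
    and G': "G' = cylinder \<C>' V'" "finite \<C>'" "\<C>' \<subseteq> sets M" "\<Union>\<C>' \<subseteq> B n'" "range V' \<subseteq> sets borel"
    by (auto simp: cylinders_def)
  let ?W = "\<lambda>C. (if C \<in> \<C> then V C else UNIV) \<inter> (if C \<in> \<C>' then V' C else UNIV)"
  have "G \<inter> G' = cylinder (\<C> \<union> \<C>') ?W"
    by (auto simp: G(1) G'(1) cylinder_def split: if_splits)
  moreover have "B n \<subseteq> B (max n n')" "B n' \<subseteq> B (max n n')"
    by (intro incseqD[OF B_incseq] max.cobounded1 max.cobounded2)+
  then have "\<Union>(\<C> \<union> \<C>') \<subseteq> B (max n n')"
    using G(4) G'(4) by auto
  moreover have "range ?W \<subseteq> sets borel"
    using G(5) G'(5) by (auto intro!: sets.Int)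
  ultimately have "G \<inter> G' = cylinder (\<C> \<union> \<C>') ?W \<and> finite (\<C> \<union> \<C>') \<and> \<C> \<union> \<C>' \<subseteq> sets M \<and>
      (\<exists>n. \<Union>(\<C> \<union> \<C>') \<subseteq> B n) \<and> range ?W \<subseteq> sets borel"
    using G(2,3) G'(2,3) by (intro conjI exI[of _ "max n n'"]) auto
  then show "G \<inter> G' \<in> cylinders"
    unfolding cylinders_def by (intro CollectI exI)
qed

lemma sets_counting_algebra_eq: "sets (counting_algebra M) = sigma_sets (counting_measures M) cylinders"
proof -
  let ?\<Sigma> = "sigma (counting_measures M) cylinders"
  have sets_\<Sigma>: "sets ?\<Sigma> = sigma_sets (counting_measures M) cylinders"
    and space_\<Sigma>: "space ?\<Sigma> = counting_measures M"
    using cylinders_subset by auto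
  have "sigma_sets (counting_measures M) cylinders \<subseteq> sets (counting_algebra M)"
  proof -
    have "G \<in> sets (counting_algebra M)" if G: "G \<in> cylinders" for G
    proof -
      obtain \<C> V where G: "G = cylinder \<C> V" "finite \<C>" "\<C> \<subseteq> sets M" "range V \<subseteq> sets borel"
        using G by (auto simp: cylinders_def)
      have "{\<eta>\<in>space (counting_algebra M). \<forall>C\<in>\<C>. emeasure \<eta> C \<in> V C} \<in> sets (counting_algebra M)"
      proof (rule sets.sets_Collect_finite_All[OF _ G(2)])
        fix C assume "C \<in> \<C>"
        then have [measurable]: "C \<in> sets M" "V C \<in> sets borel"
          using G by auto
        show "{\<eta>\<in>space (counting_algebra M). emeasure \<eta> C \<in> V C} \<in> sets (counting_algebra M)"
          by measurable
      qed
      then show ?thesis by (simp add: G(1) cylinder_def space_counting_algebra)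
    qed
    then show ?thesis
      using sets.sigma_sets_subset[of cylinders "counting_algebra M"]
      by (auto simp: space_counting_algebra)
  qed
  moreover have "sets (counting_algebra M) \<subseteq> sets ?\<Sigma>"
  proof -
    have "(\<lambda>\<eta>. \<eta>) \<in> measurable ?\<Sigma> (counting_algebra M)"
    proof (rule measurable_counting_algebra)
      fix C assume C[measurable]: "C \<in> sets M"
      have [measurable]: "(\<lambda>\<eta>. emeasure \<eta> (C \<inter> B n)) \<in> borel_measurable ?\<Sigma>" for n
      proof (rule measurableI)
        fix W :: "ennreal set" assume "W \<in> sets borel"
        then have "cylinder {C \<inter> B n} (\<lambda>_. W) \<in> cylinders"
          unfolding cylinders_def by (intro CollectI exI conjI) auto
        moreover have "(\<lambda>\<eta>. emeasure \<eta> (C \<inter> B n)) -` W \<inter> space ?\<Sigma> = cylinder {C \<inter> B n} (\<lambda>_. W)"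
          by (auto simp: cylinder_def space_\<Sigma>)
        ultimately show "(\<lambda>\<eta>. emeasure \<eta> (C \<inter> B n)) -` W \<inter> space ?\<Sigma> \<in> sets ?\<Sigma>"
          unfolding sets_\<Sigma> by auto
      qed simp
      have eq: "emeasure \<eta> C = (SUP n. emeasure \<eta> (C \<inter> B n))" if "\<eta> \<in> space ?\<Sigma>" for \<eta>
      proof -
        have sets: "sets \<eta> = sets M"
          using that by (auto simp: space_\<Sigma> sets_counting_measure)
        have "(SUP n. emeasure \<eta> (C \<inter> B n)) = emeasure \<eta> (\<Union>n. C \<inter> B n)"
          using B_incseq by (intro SUP_emeasure_incseq) (auto simp: sets incseq_def)
        also have "(\<Union>n. C \<inter> B n) = C"
          using B_exhausts sets.sets_into_space[OF C] by auto
        finally show ?thesis ..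
      qed
      show "(\<lambda>\<eta>. emeasure \<eta> C) \<in> borel_measurable ?\<Sigma>"
        by (subst measurable_cong[OF eq]) auto
    qed (simp add: space_\<Sigma>)
    from measurable_sets[OF this] show ?thesis
      using sets.sets_into_space[of _ "counting_algebra M"]
      by (auto simp: space_counting_algebra space_\<Sigma> Int_absorb2 simp del: sets_measure_of)
  qed
  ultimately show ?thesis
    unfolding sets_\<Sigma> by auto
qed

end

section \<open>The Mecke equation\<close>

locale represented_poisson_process = exhausted_space M B + P: prob_space P
  for M :: "'e measure" and B and P :: "'w measure" +
  fixes N :: "'w \<Rightarrow> 'e measure" and X :: "nat \<Rightarrow> 'w \<Rightarrow> 'e"
  assumes finite_B: "\<And>n. emeasure M (B n) < \<infinity>"
    and poisson: "poisson_random_measure P M N"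
    and represented: "represented_by P M N X"
begin

lemma N_measurable[measurable]: "N \<in> measurable P (counting_algebra M)"
  using poisson by (simp add: poisson_random_measure_def)

lemma X_measurable[measurable]: "X n \<in> measurable P M"
  using represented by (simp add: represented_by_def)

lemma N_counting: "\<omega> \<in> space P \<Longrightarrow> N \<omega> \<in> counting_measures M"
  using measurable_space[OF N_measurable] by (simp add: space_counting_algebra)

lemma sets_N: "\<omega> \<in> space P \<Longrightarrow> sets (N \<omega>) = sets M"
  using N_counting sets_counting_measure by blast

sublocale M: sigma_finite_measure M
proof
  show "\<exists>A. countable A \<and> A \<subseteq> sets M \<and> \<Union>A = space M \<and> (\<forall>a\<in>A. emeasure M a \<noteq> \<infinity>)"
    using finite_B B_exhausts by (intro exI[of _ "range B"]) (auto simp: less_top)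
qed

sublocale PM: pair_sigma_finite P M ..

lemma measurable_add_point_N[measurable]:
  "(\<lambda>p. add_point (N (fst p)) (snd p)) \<in> measurable (P \<Otimes>\<^sub>M M) (counting_algebra M)"
proof -
  have "(\<lambda>p. (N (fst p), snd p)) \<in> measurable (P \<Otimes>\<^sub>M M) (counting_algebra M \<Otimes>\<^sub>M M)"
    by measurable
  from measurable_compose[OF this measurable_add_point] show ?thesis by simp
qed

text \<open>
  The core of the Mecke equation. On the atoms of the finitely many sets involved, the
  process is a vector of independent Poisson variables, membership in \<open>G\<close> is a function \<open>g\<close> of
  that vector, and adding a point of the \<open>j\<close>-th atom raises the \<open>j\<close>-th coordinate by one. So the
  assertion is the size-bias identity, summed over the atoms inside \<open>D\<close>.
\<close>
lemma mecke_cylinder: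
  assumes G: "G \<in> cylinders" and D: "D \<in> sets M" "D \<subseteq> B n"
  shows "(\<integral>\<^sup>+\<omega>. emeasure (N \<omega>) D * indicator G (N \<omega>) \<partial>P) =
    (\<integral>\<^sup>+x. indicator D x * (\<integral>\<^sup>+\<omega>. indicator G (add_point (N \<omega>) x) \<partial>P) \<partial>M)"
proof -
  obtain \<C> V m where \<C>: "G = cylinder \<C> V" "finite \<C>" "\<C> \<subseteq> sets M" "\<Union>\<C> \<subseteq> B m" "range V \<subseteq> sets borel"
    using G by (auto simp: cylinders_def)
  have "B n \<subseteq> B (max n m)" "B m \<subseteq> B (max n m)"
    by (intro incseqD[OF B_incseq] max.cobounded1 max.cobounded2)+
  then have sub: "\<Union>(insert D \<C>) \<subseteq> B (max n m)"
    using D(2) \<C>(4) by auto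
  obtain A :: "nat \<Rightarrow> 'e set" and I and S
    where I: "finite I" and A: "A ` I \<subseteq> sets M" "disjoint_family_on A I" "\<And>i. i \<in> I \<Longrightarrow> A i \<subseteq> B (max n m)"
      and S: "\<And>C. C \<in> insert D \<C> \<Longrightarrow> S C \<subseteq> I" "\<And>C. C \<in> insert D \<C> \<Longrightarrow> C = (\<Union>i\<in>S C. A i)"
      and mem: "\<And>C i x. C \<in> insert D \<C> \<Longrightarrow> i \<in> I \<Longrightarrow> x \<in> A i \<Longrightarrow> x \<in> C \<longleftrightarrow> i \<in> S C"
    by (rule atoms_of_finite_family[of "insert D \<C>" M "B (max n m)"])
      (use \<C> D sub in auto)
  define h where "h i \<omega> = emeasure (N \<omega>) (A i)" for i \<omega>
  have A_sets[measurable]: "i \<in> I \<Longrightarrow> A i \<in> sets M" for i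
    using A by auto
  have A_finite: "i \<in> I \<Longrightarrow> emeasure M (A i) < \<infinity>" for i
    using A(3)[of i] finite_B[of "max n m"] by (auto intro: le_less_trans[OF emeasure_mono])
  have h_meas[measurable]: "i \<in> I \<Longrightarrow> h i \<in> borel_measurable P" for i
    unfolding h_def by measurable
  have indep: "P.indep_vars (\<lambda>_. borel) h I"
    using poisson I A unfolding poisson_random_measure_def h_def by auto
  have pois: "P.prob {\<omega>\<in>space P. h i \<omega> = of_nat k} =
      measure M (A i) ^ k / fact k * exp (- measure M (A i))" if "i \<in> I" for i k
    using poisson A_sets[OF that] A_finite[OF that]
    unfolding poisson_random_measure_def h_def by auto
  have N_eq: "emeasure \<eta> C = (\<Sum>i\<in>S C. emeasure \<eta> (A i))"
    if "sets \<eta> = sets M" "C \<in> insert D \<C>" for \<eta> C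
  proof -
    have "emeasure \<eta> (\<Union>i\<in>S C. A i) = (\<Sum>i\<in>S C. emeasure \<eta> (A i))"
      using that S(1)[OF that(2)] I A
      by (intro sum_emeasure[symmetric])
        (auto intro: finite_subset disjoint_family_on_mono)
    then show ?thesis
      using S(2)[OF that(2)] by simp
  qed
  define g :: "(nat \<Rightarrow> ennreal) \<Rightarrow> ennreal"
    where "g u = (if \<forall>C\<in>\<C>. (\<Sum>i\<in>S C. u i) \<in> V C then 1 else 0)" for u
  have g[measurable]: "g \<in> borel_measurable (Pi\<^sub>M I (\<lambda>_. borel))"
  proof -
    let ?\<Pi> = "Pi\<^sub>M I (\<lambda>_. borel :: ennreal measure)"
    have "{u\<in>space ?\<Pi>. \<forall>C\<in>\<C>. (\<Sum>i\<in>S C. u i) \<in> V C} \<in> sets ?\<Pi>"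
    proof (rule sets.sets_Collect_finite_All[OF _ \<C>(2)])
      fix C assume C: "C \<in> \<C>"
      have [measurable]: "V C \<in> sets borel"
        using \<C>(5) by auto
      have [measurable]: "(\<lambda>u. u i) \<in> borel_measurable (Pi\<^sub>M I (\<lambda>_. borel :: ennreal measure))" if "i \<in> S C" for i
        using S(1)[of C] C that by (intro measurable_component_singleton) auto
      show "{u\<in>space ?\<Pi>. (\<Sum>i\<in>S C. u i) \<in> V C} \<in> sets ?\<Pi>"
        by measurable
    qed
    then show ?thesis
      unfolding g_def by (intro measurable_If) auto
  qed
  have g_restrict: "g (\<lambda>i\<in>I. u i) = (if \<forall>C\<in>\<C>. (\<Sum>i\<in>S C. u i) \<in> V C then 1 else 0)" for u
  proof -
    have "(\<Sum>i\<in>S C. (\<lambda>i\<in>I. u i) i) = (\<Sum>i\<in>S C. u i)" if "C \<in> \<C>" for C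
      using S(1)[of C] that by (intro sum.cong) auto
    then show ?thesis
      by (simp add: g_def del: restrict_apply)
  qed
  have ind_N: "indicator G (N \<omega>) = g (\<lambda>i\<in>I. h i \<omega>)" if \<omega>: "\<omega> \<in> space P" for \<omega>
    using N_counting[OF \<omega>] N_eq[OF sets_N[OF \<omega>]]
    by (auto simp: \<C>(1) cylinder_def g_restrict indicator_def h_def)
  have ind_add: "indicator G (add_point (N \<omega>) x) = g (\<lambda>i\<in>I. if i = j then h j \<omega> + 1 else h i \<omega>)"
    if \<omega>: "\<omega> \<in> space P" and j: "j \<in> I" and x: "x \<in> A j" for \<omega> x j
  proof -
    have "emeasure (add_point (N \<omega>) x) C = (\<Sum>i\<in>S C. if i = j then h j \<omega> + 1 else h i \<omega>)"
      if C: "C \<in> \<C>" for C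
    proof -
      have fin: "finite (S C)"
        using S(1)[of C] C I by (auto intro: finite_subset)
      have "emeasure (add_point (N \<omega>) x) C = (\<Sum>i\<in>S C. h i \<omega>) + indicator C x"
        using C \<C>(3) N_eq[of "N \<omega>" C] sets_N[OF \<omega>] by (subst emeasure_add_point) (auto simp: h_def)
      also have "indicator C x = (\<Sum>i\<in>S C. if i = j then 1 else 0 :: ennreal)"
        using mem[of C j x] C j x fin by (simp add: sum.delta indicator_def)
      also have "(\<Sum>i\<in>S C. h i \<omega>) + \<dots> = (\<Sum>i\<in>S C. if i = j then h j \<omega> + 1 else h i \<omega>)"
        by (subst sum.distrib[symmetric]) (auto intro!: sum.cong)
      finally show ?thesis .
    qed
    then show ?thesis
      using add_point_counting_measure[OF N_counting[OF \<omega>], of x]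
      by (auto simp: \<C>(1) cylinder_def g_restrict indicator_def)
  qed
  let ?c = "\<lambda>j. \<integral>\<^sup>+\<omega>. g (\<lambda>i\<in>I. if i = j then h j \<omega> + 1 else h i \<omega>) \<partial>P"
  have S_D: "finite (S D)" "S D \<subseteq> I"
    using S(1)[of D] I by (auto intro: finite_subset)
  have "(\<integral>\<^sup>+\<omega>. emeasure (N \<omega>) D * indicator G (N \<omega>) \<partial>P) =
      (\<integral>\<^sup>+\<omega>. (\<Sum>j\<in>S D. h j \<omega> * g (\<lambda>i\<in>I. h i \<omega>)) \<partial>P)"
    using N_eq[OF sets_N, of _ D] by (intro nn_integral_cong) (simp add: ind_N h_def sum_distrib_right)
  also have "\<dots> = (\<Sum>j\<in>S D. \<integral>\<^sup>+\<omega>. h j \<omega> * g (\<lambda>i\<in>I. h i \<omega>) \<partial>P)"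
    using S_D by (intro nn_integral_sum) auto
  also have "\<dots> = (\<Sum>j\<in>S D. emeasure M (A j) * ?c j)"
  proof (rule sum.cong[OF refl])
    fix j assume "j \<in> S D"
    then have j: "j \<in> I" using S_D by auto
    then show "(\<integral>\<^sup>+\<omega>. h j \<omega> * g (\<lambda>i\<in>I. h i \<omega>) \<partial>P) = emeasure M (A j) * ?c j"
      using A_finite[OF j]
      by (subst P.independent_poisson_size_bias[OF indep j measure_nonneg pois[OF j] g])
        (simp add: emeasure_eq_ennreal_measure)
  qed
  also have "\<dots> = (\<Sum>j\<in>S D. \<integral>\<^sup>+x. ?c j * indicator (A j) x \<partial>M)"
  proof (rule sum.cong[OF refl])
    fix j assume "j \<in> S D"
    then have "A j \<in> sets M" using S_D by auto
    then show "emeasure M (A j) * ?c j = (\<integral>\<^sup>+x. ?c j * indicator (A j) x \<partial>M)"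
      by (simp only: nn_integral_cmult_indicator mult.commute[of "emeasure M (A j)"])
  qed
  also have "\<dots> = (\<integral>\<^sup>+x. (\<Sum>j\<in>S D. ?c j * indicator (A j) x) \<partial>M)"
  proof (rule nn_integral_sum[symmetric])
    fix j assume "j \<in> S D"
    then have "A j \<in> sets M" using S_D by auto
    then show "(\<lambda>x. ?c j * indicator (A j) x) \<in> borel_measurable M"
      by (intro borel_measurable_times_ennreal borel_measurable_const borel_measurable_indicator)
  qed
  also have "\<dots> = (\<integral>\<^sup>+x. indicator D x * (\<integral>\<^sup>+\<omega>. indicator G (add_point (N \<omega>) x) \<partial>P) \<partial>M)"
  proof (rule nn_integral_cong)
    fix x assume "x \<in> space M"
    show "(\<Sum>j\<in>S D. ?c j * indicator (A j) x) =
        indicator D x * (\<integral>\<^sup>+\<omega>. indicator G (add_point (N \<omega>) x) \<partial>P)"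
    proof (cases "x \<in> D")
      case True
      then obtain j where j: "j \<in> S D" "x \<in> A j"
        using S(2)[of D] by auto
      have unique: "j' = j" if "j' \<in> S D" "x \<in> A j'" for j'
      proof (rule ccontr)
        assume "j' \<noteq> j"
        then have "A j' \<inter> A j = {}"
          using that(1) j(1) S_D(2) by (intro disjoint_family_onD[OF A(2)]) auto
        then show False using that(2) j(2) by auto
      qed
      have "(\<Sum>j'\<in>S D. ?c j' * indicator (A j') x) = (\<Sum>j'\<in>S D. if j' = j then ?c j' else 0)"
      proof (rule sum.cong[OF refl])
        fix j' assume "j' \<in> S D"
        show "?c j' * indicator (A j') x = (if j' = j then ?c j' else 0)"
        proof (cases "j' = j")
          case True
          then have "indicator (A j') x = (1 :: ennreal)"
            using j(2) by simp
          then show ?thesis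
            by (simp only: True if_True mult_1_right simp_thms)
        next
          case False
          then have "x \<notin> A j'"
            using unique[OF \<open>j' \<in> S D\<close>] by metis
          then have "indicator (A j') x = (0 :: ennreal)"
            by simp
          then show ?thesis
            by (simp only: False if_False mult_zero_right)
        qed
      qed
      also have "\<dots> = ?c j"
        using j(1) S_D(1) by (simp only: sum.delta if_True)
      also have "\<dots> = (\<integral>\<^sup>+\<omega>. indicator G (add_point (N \<omega>) x) \<partial>P)"
        using j S_D by (intro nn_integral_cong) (auto simp: ind_add)
      finally show ?thesis using True by simp
    next
      case False
      then have "x \<notin> A j" if "j \<in> S D" for j
        using that S(2)[of D] by auto
      with False show ?thesis by simp
    qed
  qed
  finally show ?thesis .
qed

text \<open>
  Both sides are finite measures in \<open>G\<close>, equal on an intersection-stable generator.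
\<close>
lemma mecke_product:
  assumes G[measurable]: "G \<in> sets (counting_algebra M)" and D[measurable]: "D \<in> sets M" "D \<subseteq> B n"
  shows "(\<integral>\<^sup>+\<omega>. emeasure (N \<omega>) D * indicator G (N \<omega>) \<partial>P) =
    (\<integral>\<^sup>+p. indicator D (snd p) * indicator G (add_point (N (fst p)) (snd p)) \<partial>(P \<Otimes>\<^sub>M M))"
proof -
  let ?K = "counting_algebra M"
  have [measurable]: "(\<lambda>\<omega>. emeasure (N \<omega>) D) \<in> borel_measurable P"
    by measurable
  let ?\<nu>1 = "distr (density P (\<lambda>\<omega>. emeasure (N \<omega>) D)) ?K N"
  let ?\<nu>2 = "distr (density (P \<Otimes>\<^sub>M M) (\<lambda>p. indicator D (snd p))) ?K (\<lambda>p. add_point (N (fst p)) (snd p))"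
  have \<nu>1: "emeasure ?\<nu>1 G = (\<integral>\<^sup>+\<omega>. emeasure (N \<omega>) D * indicator G (N \<omega>) \<partial>P)"
    if [measurable]: "G \<in> sets ?K" for G
    by (subst emeasure_distr, simp, simp, subst emeasure_density)
      (auto intro!: nn_integral_cong simp: indicator_def)
  have \<nu>2: "emeasure ?\<nu>2 G =
      (\<integral>\<^sup>+p. indicator D (snd p) * indicator G (add_point (N (fst p)) (snd p)) \<partial>(P \<Otimes>\<^sub>M M))"
    if [measurable]: "G \<in> sets ?K" for G
    by (subst emeasure_distr, simp, simp, subst emeasure_density)
      (auto intro!: nn_integral_cong simp: indicator_def)
  have eq: "emeasure ?\<nu>1 G = emeasure ?\<nu>2 G" if "G \<in> cylinders" for G
  proof -
    have [measurable]: "G \<in> sets ?K"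
      using that unfolding sets_counting_algebra_eq by auto
    have "emeasure ?\<nu>2 G = (\<integral>\<^sup>+x. \<integral>\<^sup>+\<omega>. indicator D x * indicator G (add_point (N \<omega>) x) \<partial>P \<partial>M)"
      unfolding \<nu>2[OF \<open>G \<in> sets ?K\<close>] by (subst PM.nn_integral_snd[symmetric]) auto
    also have "\<dots> = (\<integral>\<^sup>+x. indicator D x * (\<integral>\<^sup>+\<omega>. indicator G (add_point (N \<omega>) x) \<partial>P) \<partial>M)"
    proof (rule nn_integral_cong)
      fix x assume "x \<in> space M"
      then have "(\<lambda>\<omega>. (\<omega>, x)) \<in> measurable P (P \<Otimes>\<^sub>M M)" by measurable
      from measurable_compose[OF this measurable_add_point_N]
      have [measurable]: "(\<lambda>\<omega>. add_point (N \<omega>) x) \<in> measurable P ?K" by simp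
      show "(\<integral>\<^sup>+\<omega>. indicator D x * indicator G (add_point (N \<omega>) x) \<partial>P) =
        indicator D x * (\<integral>\<^sup>+\<omega>. indicator G (add_point (N \<omega>) x) \<partial>P)"
        by (rule nn_integral_cmult) measurable
    qed
    finally show ?thesis
      using mecke_cylinder[OF that D] \<nu>1[OF \<open>G \<in> sets ?K\<close>] by simp
  qed
  have top: "counting_measures M \<in> cylinders"
    unfolding cylinders_def
    by (intro CollectI exI[of _ "{}"] exI[of _ "\<lambda>_. UNIV"]) (auto simp: cylinder_def)
  have "?\<nu>1 = ?\<nu>2"
  proof (rule measure_eqI_generator_eq[OF Int_stable_cylinders cylinders_subset eq,
        where A="\<lambda>_. counting_measures M"])
    have "emeasure ?\<nu>1 (counting_measures M) = (\<integral>\<^sup>+x. indicator D x * (\<integral>\<^sup>+\<omega>. indicator (counting_measures M) (add_point (N \<omega>) x) \<partial>P) \<partial>M)"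
      using mecke_cylinder[OF top D] sets.top[of ?K] by (subst \<nu>1) (auto simp: space_counting_algebra)
    also have "\<dots> = (\<integral>\<^sup>+x. indicator D x * (\<integral>\<^sup>+\<omega>. 1 \<partial>P) \<partial>M)"
      using add_point_counting_measure[OF N_counting]
      by (intro nn_integral_cong arg_cong2[where f="(*)"] refl) (auto simp: indicator_def)
    also have "\<dots> = emeasure M D"
      by (simp add: P.emeasure_space_1)
    also have "\<dots> \<le> emeasure M (B n)"
      using D by (intro emeasure_mono) auto
    finally show "emeasure ?\<nu>1 (counting_measures M) \<noteq> \<infinity>"
      using finite_B[of n] by (auto simp: top_unique)
  qed (use top in \<open>auto simp: sets_counting_algebra_eq\<close>)
  then show ?thesis
    using \<nu>1[OF G] \<nu>2[OF G] by simp
qed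

lemma measurable_X_index[measurable]:
  "(\<lambda>p. X (snd p) (fst p)) \<in> measurable (P \<Otimes>\<^sub>M count_space UNIV) M"
  by (rule measurable_compose_countable[where f="\<lambda>i p. X i (fst p)"]) measurable

text \<open>
  The representation by points turns integrals against the process into series of
  measurable functions of \<open>\<omega>\<close>. The exceptional null set does not depend on the integrand.
\<close>
lemma nn_integral_N:
  "AE \<omega> in P. \<forall>u\<in>borel_measurable M. (\<integral>\<^sup>+y. u y \<partial>N \<omega>) =
    (\<Sum>n. if of_nat n < emeasure (N \<omega>) (space M) then u (X n \<omega>) else 0)"
proof -
  have "AE \<omega> in P. \<forall>C\<in>sets M. emeasure (N \<omega>) C =
        (\<Sum>n. if of_nat n < emeasure (N \<omega>) (space M) then indicator C (X n \<omega>) else 0)"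
    using represented by (simp add: represented_by_def)
  then show ?thesis
    using AE_space
  proof eventually_elim
    case (elim \<omega>)
    let ?w = "\<lambda>n. if of_nat n < emeasure (N \<omega>) (space M) then 1 else 0 :: ennreal"
    let ?Q = "distr (density (count_space UNIV) ?w) M (\<lambda>n. X n \<omega>)"
    have [simp]: "X n \<omega> \<in> space M" for n
      using measurable_space[OF X_measurable elim(2)] .
    have "N \<omega> = ?Q"
    proof (rule measure_eqI)
      show "sets (N \<omega>) = sets ?Q"
        using elim(2) by (simp add: sets_N)
      fix C assume "C \<in> sets (N \<omega>)"
      then have [measurable]: "C \<in> sets M"
        using elim(2) by (simp add: sets_N)
      have "emeasure ?Q C = (\<integral>\<^sup>+n. ?w n * indicator ((\<lambda>n. X n \<omega>) -` C) n \<partial>count_space UNIV)"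
        by (subst emeasure_distr, simp, simp, subst emeasure_density) auto
      also have "\<dots> = (\<Sum>n. ?w n * indicator ((\<lambda>n. X n \<omega>) -` C) n)"
        by (rule nn_integral_count_space_nat)
      also have "\<dots> = emeasure (N \<omega>) C"
        using elim(1) \<open>C \<in> sets M\<close> by (auto intro!: suminf_cong simp: indicator_def)
      finally show "emeasure (N \<omega>) C = emeasure ?Q C" ..
    qed
    show ?case
    proof
      fix u :: "'e \<Rightarrow> ennreal" assume [measurable]: "u \<in> borel_measurable M"
      have "(\<integral>\<^sup>+y. u y \<partial>N \<omega>) = (\<integral>\<^sup>+y. u y \<partial>?Q)"
        using \<open>N \<omega> = ?Q\<close> by (rule arg_cong)
      also have "\<dots> = (\<integral>\<^sup>+n. ?w n * u (X n \<omega>) \<partial>count_space UNIV)"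
        by (subst nn_integral_distr, simp, simp, subst nn_integral_density) auto
      also have "\<dots> = (\<Sum>n. if of_nat n < emeasure (N \<omega>) (space M) then u (X n \<omega>) else 0)"
        unfolding nn_integral_count_space_nat by (intro suminf_cong) simp
      finally show "(\<integral>\<^sup>+y. u y \<partial>N \<omega>) =
        (\<Sum>n. if of_nat n < emeasure (N \<omega>) (space M) then u (X n \<omega>) else 0)" .
    qed
  qed
qed

text \<open>
  Both sides are integrals of \<open>f\<close> against measures on \<open>\<^bold>N \<times> E\<close>, here \<open>m1\<close> and \<open>m2\<close>,
  which agree on rectangles over sets inside some \<open>B n\<close>, hence on all rectangles. The
  Campbell measure \<open>m1\<close> is obtained as an image measure on \<open>\<Omega> \<times> nat\<close> through the
  representation by points, which yields its \<open>\<sigma>\<close>-additivity for free.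
\<close>
theorem mecke:
  assumes f[measurable]: "f \<in> borel_measurable (counting_algebra M \<Otimes>\<^sub>M M)"
  shows "(\<integral>\<^sup>+\<omega>. \<integral>\<^sup>+y. f (N \<omega>, y) \<partial>N \<omega> \<partial>P) =
    (\<integral>\<^sup>+p. f (add_point (N (fst p)) (snd p), snd p) \<partial>(P \<Otimes>\<^sub>M M))"
proof -
  let ?K = "counting_algebra M"
  let ?C = "P \<Otimes>\<^sub>M (count_space UNIV :: nat measure)"
  let ?w = "\<lambda>p. if of_nat (snd p) < emeasure (N (fst p)) (space M) then 1 else 0 :: ennreal"
  let ?Z = "\<lambda>p. (N (fst p), X (snd p) (fst p))"
  let ?Y = "\<lambda>p. (add_point (N (fst p)) (snd p), snd p)"
  let ?m1 = "distr (density ?C ?w) (?K \<Otimes>\<^sub>M M) ?Z"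
  let ?m2 = "distr (P \<Otimes>\<^sub>M M) (?K \<Otimes>\<^sub>M M) ?Y"
  interpret count: sigma_finite_measure "count_space UNIV :: nat measure"
    by (rule sigma_finite_measure_count_space)
  have [measurable]: "?w \<in> borel_measurable ?C"
    by measurable
  have m1: "integral\<^sup>N ?m1 f = (\<integral>\<^sup>+\<omega>. \<integral>\<^sup>+y. f (N \<omega>, y) \<partial>N \<omega> \<partial>P)"
    if [measurable]: "f \<in> borel_measurable (?K \<Otimes>\<^sub>M M)" for f
  proof -
    have "integral\<^sup>N ?m1 f = (\<integral>\<^sup>+p. ?w p * f (?Z p) \<partial>?C)"
      by (subst nn_integral_distr, simp, simp, subst nn_integral_density) auto
    also have "\<dots> = (\<integral>\<^sup>+\<omega>. \<integral>\<^sup>+n. ?w (\<omega>, n) * f (?Z (\<omega>, n)) \<partial>count_space UNIV \<partial>P)"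
      by (rule count.nn_integral_fst[symmetric]) measurable
    also have "\<dots> = (\<integral>\<^sup>+\<omega>. \<integral>\<^sup>+y. f (N \<omega>, y) \<partial>N \<omega> \<partial>P)"
    proof (rule nn_integral_cong_AE)
      show "AE \<omega> in P. (\<integral>\<^sup>+n. ?w (\<omega>, n) * f (?Z (\<omega>, n)) \<partial>count_space UNIV) = (\<integral>\<^sup>+y. f (N \<omega>, y) \<partial>N \<omega>)"
        using nn_integral_N AE_space
      proof eventually_elim
        case (elim \<omega>)
        have "N \<omega> \<in> space ?K"
          using elim(2) N_counting by (simp add: space_counting_algebra)
        then have "(\<lambda>y. f (N \<omega>, y)) \<in> borel_measurable M"
          by measurable
        with elim(1) show ?case
          unfolding nn_integral_count_space_nat by (auto intro!: suminf_cong)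
      qed
    qed
    finally show ?thesis .
  qed
  have m2: "integral\<^sup>N ?m2 f = (\<integral>\<^sup>+p. f (?Y p) \<partial>(P \<Otimes>\<^sub>M M))"
    if [measurable]: "f \<in> borel_measurable (?K \<Otimes>\<^sub>M M)" for f
    by (subst nn_integral_distr) auto
  have rect: "emeasure ?m1 (G \<times> D) = (\<integral>\<^sup>+\<omega>. emeasure (N \<omega>) D * indicator G (N \<omega>) \<partial>P)"
    "emeasure ?m2 (G \<times> D) =
      (\<integral>\<^sup>+p. indicator D (snd p) * indicator G (add_point (N (fst p)) (snd p)) \<partial>(P \<Otimes>\<^sub>M M))"
    if [measurable]: "G \<in> sets ?K" "D \<in> sets M" for G D
  proof -
    have "emeasure ?m1 (G \<times> D) = integral\<^sup>N ?m1 (indicator (G \<times> D))"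
      by (rule nn_integral_indicator[symmetric]) simp
    also have "\<dots> = (\<integral>\<^sup>+\<omega>. \<integral>\<^sup>+y. indicator (G \<times> D) (N \<omega>, y) \<partial>N \<omega> \<partial>P)"
      by (rule m1) measurable
    also have "\<dots> = (\<integral>\<^sup>+\<omega>. emeasure (N \<omega>) D * indicator G (N \<omega>) \<partial>P)"
    proof (rule nn_integral_cong)
      fix \<omega> assume "\<omega> \<in> space P"
      then have "D \<in> sets (N \<omega>)" by (simp add: sets_N that)
      then show "(\<integral>\<^sup>+y. indicator (G \<times> D) (N \<omega>, y) \<partial>N \<omega>) = emeasure (N \<omega>) D * indicator G (N \<omega>)"
        unfolding indicator_times fst_conv snd_conv by (subst nn_integral_cmult) (auto simp: mult.commute)
    qed
    finally show "emeasure ?m1 (G \<times> D) = (\<integral>\<^sup>+\<omega>. emeasure (N \<omega>) D * indicator G (N \<omega>) \<partial>P)" .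
    have "emeasure ?m2 (G \<times> D) = integral\<^sup>N ?m2 (indicator (G \<times> D))"
      by (rule nn_integral_indicator[symmetric]) simp
    also have "\<dots> = (\<integral>\<^sup>+p. indicator D (snd p) * indicator G (add_point (N (fst p)) (snd p)) \<partial>(P \<Otimes>\<^sub>M M))"
      by (subst m2) (auto simp: indicator_times mult.commute)
    finally show "emeasure ?m2 (G \<times> D) =
      (\<integral>\<^sup>+p. indicator D (snd p) * indicator G (add_point (N (fst p)) (snd p)) \<partial>(P \<Otimes>\<^sub>M M))" .
  qed
  have eq_B: "emeasure ?m1 (G \<times> D) = emeasure ?m2 (G \<times> D)"
    if "G \<in> sets ?K" "D \<in> sets M" "D \<subseteq> B n" for G D n
    using rect[OF that(1,2)] mecke_product[OF that] by simp
  have eq: "emeasure ?m1 (G \<times> D) = emeasure ?m2 (G \<times> D)"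
    if G: "G \<in> sets ?K" and D: "D \<in> sets M" for G D
  proof -
    have union: "(\<Union>n. G \<times> (D \<inter> B n)) = G \<times> D"
      using B_exhausts sets.sets_into_space[OF D] by auto
    have lim: "(SUP n. emeasure m (G \<times> (D \<inter> B n))) = emeasure m (G \<times> D)"
      if m: "sets m = sets (?K \<Otimes>\<^sub>M M)" for m
      unfolding union[symmetric] using B_incseq G D
      by (intro SUP_emeasure_incseq) (auto simp: m incseq_def subset_eq)
    have "emeasure ?m1 (G \<times> (D \<inter> B n)) = emeasure ?m2 (G \<times> (D \<inter> B n))" for n
      using G D by (intro eq_B[of _ _ n]) auto
    then show ?thesis
      using lim[of ?m1] lim[of ?m2] by simp
  qed
  let ?E = "{a \<times> b |a b. a \<in> sets ?K \<and> b \<in> sets M}"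
  have "?m1 = ?m2"
  proof (rule measure_eqI_generator_eq[OF Int_stable_pair_measure_generator[of ?K M],
        where \<Omega>="space ?K \<times> space M" and A="\<lambda>n. space ?K \<times> B n"])
    show "?E \<subseteq> Pow (space ?K \<times> space M)"
      using sets.sets_into_space[of _ ?K] sets.sets_into_space[of _ M] by blast
    show "emeasure ?m1 E = emeasure ?m2 E" if "E \<in> ?E" for E
      using that eq by auto
    show "(\<Union>n. space ?K \<times> B n) = space ?K \<times> space M"
      using B_exhausts by auto
    show "range (\<lambda>n. space ?K \<times> B n) \<subseteq> ?E"
      using sets.top[of ?K] B_sets by blast
    fix n
    have "emeasure ?m2 (space ?K \<times> B n) \<le> (\<integral>\<^sup>+p. indicator (space P \<times> B n) p \<partial>(P \<Otimes>\<^sub>M M))"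
      unfolding rect(2)[OF sets.top B_sets]
      by (intro nn_integral_mono) (auto simp: indicator_def space_pair_measure)
    also have "\<dots> = emeasure M (B n)"
      by (simp add: M.emeasure_pair_measure_Times P.emeasure_space_1)
    finally show "emeasure ?m1 (space ?K \<times> B n) \<noteq> \<infinity>"
      using finite_B[of n] eq[OF sets.top B_sets] by (auto simp: top_unique)
  qed (auto simp: sets_pair_measure)
  then show ?thesis
    using m1[OF f] m2[OF f] by simp
qed

end

section \<open>The pathwise identity\<close>

context exhausted_space
begin

lemma measurable_add_point_lf_raw[measurable (raw)]:
  assumes [measurable]: "f \<in> measurable L lf_algebra" "g \<in> measurable L M"
  shows "(\<lambda>z. add_point (f z) (g z)) \<in> measurable L lf_algebra"
  using measurable_compose[OF measurable_Pair[OF assms] measurable_add_point_lf] by simp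

lemma measurable_remove_point_lf_raw[measurable (raw)]:
  assumes [measurable]: "f \<in> measurable L lf_algebra" "g \<in> measurable L M"
  shows "(\<lambda>z. remove_point (f z) (g z)) \<in> measurable L lf_algebra"
  using measurable_compose[OF measurable_Pair[OF assms] measurable_remove_point_lf] by simp

lemma measurable_mass_at_point_raw[measurable (raw)]:
  assumes [measurable]: "f \<in> measurable L lf_algebra" "g \<in> measurable L M"
  shows "(\<lambda>z. emeasure (f z) {g z}) \<in> borel_measurable L"
  using measurable_compose[OF measurable_Pair[OF assms] measurable_mass_at_point] by simp

text \<open>
  A measurable retraction onto the measures that are finite on every \<open>B n\<close>; it replaces a
  property that holds almost surely by one that holds everywhere.
\<close>
definition lf_part :: "'e measure \<Rightarrow> 'e measure" where
  "lf_part \<eta> = (if \<eta> \<in> space lf_algebra then \<eta> else null_measure M)"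

lemma null_measure_lf: "null_measure M \<in> space lf_algebra"
proof -
  have "sigma_finite_measure (null_measure M)"
    by (intro sigma_finite_measure.intro exI[of _ "{space M}"]) auto
  then show ?thesis
    by (auto simp: space_lf_algebra counting_measures_def intro!: image_eqI[of _ _ 0])
qed

lemma lf_part_measurable[measurable]: "lf_part \<in> measurable (counting_algebra M) lf_algebra"
proof (rule measurable_lf_algebra)
  fix C assume [measurable]: "C \<in> sets M"
  show "(\<lambda>\<eta>. emeasure (lf_part \<eta>) C) \<in> borel_measurable (counting_algebra M)"
    by (subst measurable_cong[where g="\<lambda>\<eta>. if \<forall>n. emeasure \<eta> (B n) < \<infinity> then emeasure \<eta> C else 0"])
      (auto simp: lf_part_def space_lf_algebra space_counting_algebra)
qed (simp add: lf_part_def null_measure_lf)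

lemma lf_part_eq: "\<eta> \<in> space lf_algebra \<Longrightarrow> lf_part \<eta> = \<eta>"
  by (simp add: lf_part_def)

lemma add_point_in_lf: "\<eta> \<in> space lf_algebra \<Longrightarrow> x \<in> space M \<Longrightarrow> add_point \<eta> x \<in> space lf_algebra"
  using measurable_space[OF measurable_add_point_lf, of "(\<eta>, x)"] by (simp add: space_pair_measure)

lemma measurable_lf_cong: "\<eta> \<in> space lf_algebra \<Longrightarrow> measurable \<eta> L = measurable M L"
  by (intro measurable_cong_sets sets_lf refl)

text \<open>
  The pathwise integral as a function of the counting measure. Unlike
  \<open>kabanov_skorohod\<close> it takes a function on \<open>\<^bold>N \<times> E\<close> and can therefore be evaluated
  at \<open>\<eta> + \<delta>\<^sub>x\<close>.
\<close>
definition skorohod :: "('e measure \<times> 'e \<Rightarrow> 'h::{banach, second_countable_topology}) \<Rightarrow> 'e measure \<Rightarrow> 'h" where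
  "skorohod \<phi> \<eta> = (\<integral>y. \<phi> (remove_point \<eta> y, y) \<partial>\<eta>) - (\<integral>y. \<phi> (\<eta>, y) \<partial>M)"

definition point_difference :: "('e measure \<times> 'e \<Rightarrow> 'h::{banach, second_countable_topology}) \<Rightarrow> 'e \<Rightarrow> 'e measure \<times> 'e \<Rightarrow> 'h" where
  "point_difference \<phi> x = (\<lambda>(\<eta>, y). \<phi> (add_point \<eta> x, y) - \<phi> (\<eta>, y))"

text \<open>
  The commutation relation for a fixed configuration. The new point \<open>x\<close> contributes
  \<open>\<phi>((\<eta> + \<delta>\<^sub>x) \ \<delta>\<^sub>x, x) = \<phi>(\<eta>, x)\<close>. At the old points
  \<open>(\<eta> + \<delta>\<^sub>x) \ \<delta>\<^sub>y = \<eta> \ \<delta>\<^sub>y + \<delta>\<^sub>x\<close>, so that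
  the change is the difference of \<open>\<phi>\<close> taken at \<open>\<eta> \ \<delta>\<^sub>y\<close>. Integrability is needed
  to split the integrals.
\<close>
lemma skorohod_add_point:
  fixes \<phi> :: "'e measure \<times> 'e \<Rightarrow> 'h::{banach, second_countable_topology}"
  assumes \<phi>[measurable]: "\<phi> \<in> borel_measurable (lf_algebra \<Otimes>\<^sub>M M)"
    and \<eta>[measurable]: "\<eta> \<in> space lf_algebra" and x[measurable]: "x \<in> space M"
    and atoms: "AE y in \<eta>. 1 \<le> emeasure \<eta> {y}"
    and int\<eta>: "integrable \<eta> (\<lambda>y. \<phi> (remove_point \<eta> y, y))"
      "integrable \<eta> (\<lambda>y. point_difference \<phi> x (remove_point \<eta> y, y))"
    and intM: "integrable M (\<lambda>y. \<phi> (\<eta>, y))" "integrable M (\<lambda>y. point_difference \<phi> x (\<eta>, y))"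
  shows "skorohod \<phi> (add_point \<eta> x) - skorohod \<phi> \<eta> = skorohod (point_difference \<phi> x) \<eta> + \<phi> (\<eta>, x)"
proof -
  note [measurable] = add_point_in_lf[OF \<eta> x]
  let ?g = "\<lambda>y. \<phi> (remove_point (add_point \<eta> x) y, y)"
  let ?h = "\<lambda>y. \<phi> (remove_point \<eta> y, y) + point_difference \<phi> x (remove_point \<eta> y, y)"
  have g: "?g \<in> borel_measurable \<eta>"
    unfolding measurable_lf_cong[OF \<eta>] by measurable
  have h: "integrable \<eta> ?h"
    using int\<eta> by (rule Bochner_Integration.integrable_add)
  have gh: "AE y in \<eta>. ?g y = ?h y"
    using atoms AE_space
  proof eventually_elim
    case (elim y)
    then have "{y} \<in> sets \<eta>"
      using singleton_sets \<eta> by (simp add: sets_lf space_lf)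
    from remove_add_point_commute[OF this elim(1)] show ?case
      by (simp add: point_difference_def)
  qed
  have g_int: "integrable \<eta> ?g"
    using integrable_cong_AE[THEN iffD2, OF g _ gh h] h by auto
  have "(\<integral>y. ?g y \<partial>add_point \<eta> x) = (\<integral>y. ?g y \<partial>\<eta>) + ?g x"
    using x by (intro integral_add_point[OF g_int]) (simp add: space_lf[OF \<eta>])
  also have "?g x = \<phi> (\<eta>, x)"
    using singleton_sets[OF x] by (simp add: remove_add_point sets_lf[OF \<eta>])
  also have "(\<integral>y. ?g y \<partial>\<eta>) = (\<integral>y. ?h y \<partial>\<eta>)"
    using g h gh by (intro integral_cong_AE) auto
  also have "\<dots> = (\<integral>y. \<phi> (remove_point \<eta> y, y) \<partial>\<eta>) + (\<integral>y. point_difference \<phi> x (remove_point \<eta> y, y) \<partial>\<eta>)"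
    using int\<eta> by (rule Bochner_Integration.integral_add)
  finally have 1: "(\<integral>y. ?g y \<partial>add_point \<eta> x) = (\<integral>y. \<phi> (remove_point \<eta> y, y) \<partial>\<eta>)
      + (\<integral>y. point_difference \<phi> x (remove_point \<eta> y, y) \<partial>\<eta>) + \<phi> (\<eta>, x)" .
  have "(\<integral>y. \<phi> (add_point \<eta> x, y) \<partial>M) = (\<integral>y. \<phi> (\<eta>, y) + point_difference \<phi> x (\<eta>, y) \<partial>M)"
    by (simp add: point_difference_def)
  also have "\<dots> = (\<integral>y. \<phi> (\<eta>, y) \<partial>M) + (\<integral>y. point_difference \<phi> x (\<eta>, y) \<partial>M)"
    using intM by (rule Bochner_Integration.integral_add)
  finally show ?thesis
    unfolding skorohod_def 1 by simp
qed

end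

section \<open>Transfer to the operators\<close>

context represented_poisson_process
begin

text \<open>
  A version of the process all of whose realizations are finite on every \<open>B n\<close>.
\<close>
definition N' :: "'w \<Rightarrow> 'e measure" where
  "N' \<omega> = lf_part (N \<omega>)"

lemma N'_measurable[measurable]: "N' \<in> measurable P lf_algebra"
  unfolding N'_def by measurable

lemma N'_lf: "\<omega> \<in> space P \<Longrightarrow> N' \<omega> \<in> space lf_algebra"
  by (rule measurable_space[OF N'_measurable])

lemma AE_N_eq_N': "AE \<omega> in P. N \<omega> = N' \<omega>"
proof -
  have "AE \<omega> in P. \<exists>k::nat. emeasure (N \<omega>) (B n) = of_nat k" for n
    using poisson finite_B[of n]
    by (intro P.poisson_AE_nat[where l="measure M (B n)"]) (auto simp: poisson_random_measure_def)
  then have "AE \<omega> in P. \<forall>n. \<exists>k::nat. emeasure (N \<omega>) (B n) = of_nat k"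
    by (simp add: AE_all_countable)
  then show ?thesis
    using AE_space
  proof eventually_elim
    case (elim \<omega>)
    have "emeasure (N \<omega>) (B n) < \<infinity>" for n
      using elim(1) by (metis infinity_ennreal_def of_nat_less_top)
    then have "N \<omega> \<in> space lf_algebra"
      using N_counting[OF elim(2)] by (simp add: space_lf_algebra)
    then show ?case
      by (simp add: N'_def lf_part_eq)
  qed
qed

lemma AE_pair_N_eq_N': "AE p in P \<Otimes>\<^sub>M M. N (fst p) = N' (fst p)"
  using M.sigma_finite_measure_axioms AE_N_eq_N' by (rule AE_pair_fst)

lemma mecke_lf:
  assumes f[measurable]: "f \<in> borel_measurable (lf_algebra \<Otimes>\<^sub>M M)"
  shows "(\<integral>\<^sup>+\<omega>. \<integral>\<^sup>+y. f (N' \<omega>, y) \<partial>N' \<omega> \<partial>P) =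
    (\<integral>\<^sup>+p. f (add_point (N' (fst p)) (snd p), snd p) \<partial>(P \<Otimes>\<^sub>M M))"
proof -
  have "(\<integral>\<^sup>+\<omega>. \<integral>\<^sup>+y. f (N' \<omega>, y) \<partial>N' \<omega> \<partial>P) = (\<integral>\<^sup>+\<omega>. \<integral>\<^sup>+y. f (lf_part (N \<omega>), y) \<partial>N \<omega> \<partial>P)"
    by (intro nn_integral_cong_AE) (use AE_N_eq_N' in eventually_elim, simp add: N'_def)
  also have "\<dots> = (\<integral>\<^sup>+p. f (lf_part (add_point (N (fst p)) (snd p)), snd p) \<partial>(P \<Otimes>\<^sub>M M))"
    using mecke[of "\<lambda>p. f (lf_part (fst p), snd p)"] by simp
  also have "\<dots> = (\<integral>\<^sup>+p. f (add_point (N' (fst p)) (snd p), snd p) \<partial>(P \<Otimes>\<^sub>M M))"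
  proof (rule nn_integral_cong_AE)
    show "AE p in P \<Otimes>\<^sub>M M. f (lf_part (add_point (N (fst p)) (snd p)), snd p) =
        f (add_point (N' (fst p)) (snd p), snd p)"
      using AE_pair_N_eq_N' AE_space
    proof eventually_elim
      case (elim p)
      then have "add_point (N' (fst p)) (snd p) \<in> space lf_algebra"
        by (intro add_point_in_lf N'_lf) (auto simp: space_pair_measure)
      with elim(1) show ?case by (simp add: lf_part_eq)
    qed
  qed
  finally show ?thesis .
qed

text \<open>
  The Mecke equation for indicators: the law of \<open>(N + \<delta>\<^sub>x, x)\<close> under
  \<open>P \<times> \<mu>\<close> coincides with that of \<open>(N, y)\<close> under \<open>P \<times> N\<close>, so both have the same null sets.
\<close>
lemma mecke_AE:
  assumes [measurable]: "Measurable.pred (lf_algebra \<Otimes>\<^sub>M M) Q"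
  shows "(AE \<omega> in P. AE y in N' \<omega>. Q (N' \<omega>, y)) \<longleftrightarrow>
    (AE p in P \<Otimes>\<^sub>M M. Q (add_point (N' (fst p)) (snd p), snd p))"
proof -
  let ?f = "\<lambda>z. if Q z then 0 else 1 :: ennreal"
  have [measurable]: "(\<lambda>\<omega>. \<integral>\<^sup>+y. ?f (N' \<omega>, y) \<partial>N' \<omega>) \<in> borel_measurable P"
    using borel_measurable_nn_integral_lf[OF N'_measurable, of "\<lambda>p. ?f (N' (fst p), snd p)"] by simp
  have "(AE \<omega> in P. AE y in N' \<omega>. Q (N' \<omega>, y)) \<longleftrightarrow>
      (AE \<omega> in P. (\<integral>\<^sup>+y. ?f (N' \<omega>, y) \<partial>N' \<omega>) = 0)"
  proof (rule AE_cong)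
    fix \<omega> assume \<omega>: "\<omega> \<in> space P"
    then have "(\<lambda>y. ?f (N' \<omega>, y)) \<in> borel_measurable (N' \<omega>)"
      unfolding measurable_lf_cong[OF N'_lf[OF \<omega>]] using N'_lf[OF \<omega>] by measurable
    then show "(AE y in N' \<omega>. Q (N' \<omega>, y)) \<longleftrightarrow> (\<integral>\<^sup>+y. ?f (N' \<omega>, y) \<partial>N' \<omega>) = 0"
      by (subst nn_integral_0_iff_AE) (auto split: if_splits)
  qed
  also have "\<dots> \<longleftrightarrow> (\<integral>\<^sup>+\<omega>. \<integral>\<^sup>+y. ?f (N' \<omega>, y) \<partial>N' \<omega> \<partial>P) = 0"
    by (rule nn_integral_0_iff_AE[symmetric]) measurable
  also have "\<dots> \<longleftrightarrow> (\<integral>\<^sup>+p. ?f (add_point (N' (fst p)) (snd p), snd p) \<partial>(P \<Otimes>\<^sub>M M)) = 0"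
    by (subst mecke_lf) auto
  also have "\<dots> \<longleftrightarrow> (AE p in P \<Otimes>\<^sub>M M. Q (add_point (N' (fst p)) (snd p), snd p))"
    by (subst nn_integral_0_iff_AE) (auto split: if_splits)
  finally show ?thesis .
qed

text \<open>
  Two functions on \<open>\<^bold>N\<close> that agree at \<open>N\<close> almost surely also agree at \<open>N + \<delta>\<^sub>x\<close>;
  hence the difference operator does not depend on the representing function.
\<close>
lemma AE_add_point:
  assumes [measurable]: "Measurable.pred lf_algebra Q" and Q: "AE \<omega> in P. Q (N' \<omega>)"
  shows "AE p in P \<Otimes>\<^sub>M M. Q (add_point (N' (fst p)) (snd p))"
proof -
  have "AE \<omega> in P. AE y in N' \<omega>. Q (fst (N' \<omega>, y))"
    using Q by eventually_elim simp
  then show ?thesis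
    by (subst (asm) mecke_AE) auto
qed

lemma remove_add_N':
  assumes "p \<in> space (P \<Otimes>\<^sub>M M)"
  shows "remove_point (add_point (N' (fst p)) (snd p)) (snd p) = N' (fst p)"
  using assms singleton_sets N'_lf
  by (intro remove_add_point) (auto simp: space_pair_measure sets_lf)

text \<open>
  The same for the map \<open>y \<mapsto> (N \ \<delta>\<^sub>y, y)\<close> under \<open>P \<times> N\<close>, which the Mecke equation
  transforms into \<open>(N, y)\<close> under \<open>P \<times> \<mu>\<close>; hence \<open>\<epsilon>\<^sup>-\<close> does not depend on the
  representing function.
\<close>
lemma AE_remove_point:
  assumes [measurable]: "Measurable.pred (lf_algebra \<Otimes>\<^sub>M M) Q"
    and Q: "AE p in P \<Otimes>\<^sub>M M. Q (N' (fst p), snd p)"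
  shows "AE \<omega> in P. AE y in N' \<omega>. Q (remove_point (N' \<omega>) y, y)"
proof -
  have "AE p in P \<Otimes>\<^sub>M M. Q (remove_point (add_point (N' (fst p)) (snd p)) (snd p), snd p)"
    using Q AE_space by eventually_elim (simp add: remove_add_N')
  then show ?thesis
    using mecke_AE[of "\<lambda>z. Q (remove_point (fst z) (snd z), snd z)"] by simp
qed

lemma AE_atoms: "AE \<omega> in P. AE y in N' \<omega>. 1 \<le> emeasure (N' \<omega>) {y}"
proof -
  have "AE p in P \<Otimes>\<^sub>M M. 1 \<le> emeasure (add_point (N' (fst p)) (snd p)) {snd p}"
    using AE_space
  proof eventually_elim
    case (elim p)
    then have "{snd p} \<in> sets (N' (fst p))"
      using singleton_sets N'_lf by (auto simp: space_pair_measure sets_lf)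
    then show ?case by (simp add: emeasure_add_point)
  qed
  then show ?thesis
    using mecke_AE[of "\<lambda>z. 1 \<le> emeasure (fst z) {snd z}"] by simp
qed

text \<open>
  By the Mecke equation the expectation of this integral is the \<open>L\<^sup>1\<close> norm of
  \<open>\<phi>(N, y)\<close> over the product space.
\<close>
lemma AE_integrable_remove_point:
  fixes \<phi> :: "'e measure \<times> 'e \<Rightarrow> 'h::{banach, second_countable_topology}"
  assumes [measurable]: "\<phi> \<in> borel_measurable (lf_algebra \<Otimes>\<^sub>M M)"
    and int: "integrable (P \<Otimes>\<^sub>M M) (\<lambda>p. \<phi> (N' (fst p), snd p))"
  shows "AE \<omega> in P. (\<integral>\<^sup>+y. norm (\<phi> (remove_point (N' \<omega>) y, y)) \<partial>N' \<omega>) < \<infinity>"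
proof -
  let ?f = "\<lambda>z. ennreal (norm (\<phi> (remove_point (fst z) (snd z), snd z)))"
  have "(\<integral>\<^sup>+\<omega>. \<integral>\<^sup>+y. ?f (N' \<omega>, y) \<partial>N' \<omega> \<partial>P) =
      (\<integral>\<^sup>+p. ?f (add_point (N' (fst p)) (snd p), snd p) \<partial>(P \<Otimes>\<^sub>M M))"
    by (rule mecke_lf) measurable
  also have "\<dots> = (\<integral>\<^sup>+p. norm (\<phi> (N' (fst p), snd p)) \<partial>(P \<Otimes>\<^sub>M M))"
    by (intro nn_integral_cong) (simp add: remove_add_N')
  also have "\<dots> < \<infinity>"
    using int by (simp add: integrable_iff_bounded)
  finally have fin: "(\<integral>\<^sup>+\<omega>. \<integral>\<^sup>+y. ?f (N' \<omega>, y) \<partial>N' \<omega> \<partial>P) \<noteq> \<infinity>"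
    by simp
  have "(\<lambda>\<omega>. \<integral>\<^sup>+y. ?f (N' \<omega>, y) \<partial>N' \<omega>) \<in> borel_measurable P"
    using borel_measurable_nn_integral_lf[OF N'_measurable, of "\<lambda>p. ?f (N' (fst p), snd p)"] by simp
  from nn_integral_noteq_infinite[OF this fin] show ?thesis
    by (simp add: less_top)
qed

text \<open>
  For statements known for almost every fixed \<open>x\<close>, almost surely. Measurability of the
  exceptional set in the product is indispensable for this direction of Fubini's theorem.
\<close>
lemma AE_swap:
  assumes "Measurable.pred (P \<Otimes>\<^sub>M M) Q" and "AE x in M. AE \<omega> in P. Q (\<omega>, x)"
  shows "AE p in P \<Otimes>\<^sub>M M. Q p"
proof -
  have Q: "{p\<in>space (P \<Otimes>\<^sub>M M). Q p} \<in> sets (P \<Otimes>\<^sub>M M)"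
    using assms(1) by (simp add: pred_def)
  then have "AE \<omega> in P. AE x in M. Q (\<omega>, x)"
    using assms(2) PM.AE_commute[of "\<lambda>\<omega> x. Q (\<omega>, x)"] by simp
  with Q show ?thesis
    by (rule PM.AE_pair_measure)
qed

lemma skorohod_measurable:
  fixes \<phi> :: "'e measure \<times> 'e \<Rightarrow> 'h::{banach, second_countable_topology}"
  assumes [measurable]: "\<phi> \<in> borel_measurable (lf_algebra \<Otimes>\<^sub>M M)"
  shows "skorohod \<phi> \<in> borel_measurable lf_algebra"
proof -
  have [measurable]: "(\<lambda>\<eta>. \<integral>y. \<phi> (remove_point \<eta> y, y) \<partial>\<eta>) \<in> borel_measurable lf_algebra"
    using borel_measurable_integral_lf[of "\<lambda>\<eta>. \<eta>" lf_algebra "\<lambda>z. \<phi> (remove_point (fst z) (snd z), snd z)"]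
    by simp
  show ?thesis
    unfolding skorohod_def by measurable
qed

text \<open>
  This provides the joint measurability in \<open>\<omega>\<close> and \<open>x\<close> that a joint version of
  \<open>x \<mapsto> \<delta>(D\<^sub>x\<Phi>)\<close> requires. The operator \<open>\<delta>\<close> itself picks a representing function
  of \<open>D\<^sub>x\<Phi>\<close> for each \<open>x\<close> separately.
\<close>
lemma skorohod_point_difference_measurable:
  fixes \<phi> :: "'e measure \<times> 'e \<Rightarrow> 'h::{banach, second_countable_topology}"
  assumes [measurable]: "\<phi> \<in> borel_measurable (lf_algebra \<Otimes>\<^sub>M M)"
  shows "(\<lambda>z. skorohod (point_difference \<phi> (snd z)) (fst z)) \<in> borel_measurable (lf_algebra \<Otimes>\<^sub>M M)"
proof -
  have [measurable]: "(\<lambda>z. \<integral>y. point_difference \<phi> (snd z) (remove_point (fst z) y, y) \<partial>fst z)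
      \<in> borel_measurable (lf_algebra \<Otimes>\<^sub>M M)"
    using borel_measurable_integral_lf[of fst "lf_algebra \<Otimes>\<^sub>M M"
      "\<lambda>u. point_difference \<phi> (snd (fst u)) (remove_point (fst (fst u)) (snd u), snd u)"]
    by (simp add: point_difference_def)
  have [measurable]: "(\<lambda>z. \<integral>y. point_difference \<phi> (snd z) (fst z, y) \<partial>M)
      \<in> borel_measurable (lf_algebra \<Otimes>\<^sub>M M)"
    unfolding point_difference_def by simp
  show ?thesis
    unfolding skorohod_def by measurable
qed

lemma represents_lf_measurable:
  assumes "represents\<^sub>\<Omega>\<^sub>E P M N \<Phi> \<phi>"
  shows "\<phi> \<in> borel_measurable (lf_algebra \<Otimes>\<^sub>M M)"
proof -
  have [measurable]: "\<phi> \<in> borel_measurable (counting_algebra M \<Otimes>\<^sub>M M)"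
    using assms by (simp add: represents\<^sub>\<Omega>\<^sub>E_def)
  have "(\<lambda>z. \<phi> (fst z, snd z)) \<in> borel_measurable (lf_algebra \<Otimes>\<^sub>M M)"
    by measurable
  then show ?thesis by simp
qed

lemma represents_N':
  assumes "represents\<^sub>\<Omega>\<^sub>E P M N \<Phi> \<phi>"
  shows "AE p in P \<Otimes>\<^sub>M M. \<Phi> p = \<phi> (N' (fst p), snd p)"
proof -
  have "AE p in P \<Otimes>\<^sub>M M. \<Phi> p = \<phi> (N (fst p), snd p)"
    using assms by (simp add: represents\<^sub>\<Omega>\<^sub>E_def split_beta')
  then show ?thesis
    using AE_pair_N_eq_N' by eventually_elim simp
qed

text \<open>
  The chosen representing function may be exchanged for any other, by the invariance of
  \<open>\<epsilon>\<^sup>-\<close> under such exchanges.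
\<close>
lemma kabanov_skorohod_eq_skorohod:
  fixes \<Phi> :: "'w \<times> 'e \<Rightarrow> 'h::{real_inner, banach, second_countable_topology}"
  assumes \<Phi>[measurable]: "\<Phi> \<in> borel_measurable (P \<Otimes>\<^sub>M M)"
    and rep: "represents\<^sub>\<Omega>\<^sub>E P M N \<Phi> \<phi>"
  shows "AE \<omega> in P. kabanov_skorohod P M N \<Phi> \<omega> = skorohod \<phi> (N' \<omega>)"
proof -
  define \<psi> where "\<psi> = (SOME \<psi>. represents\<^sub>\<Omega>\<^sub>E P M N \<Phi> \<psi>)"
  have \<psi>: "represents\<^sub>\<Omega>\<^sub>E P M N \<Phi> \<psi>"
    unfolding \<psi>_def by (rule someI[of "represents\<^sub>\<Omega>\<^sub>E P M N \<Phi>", OF rep])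
  note [measurable] = represents_lf_measurable[OF rep] represents_lf_measurable[OF \<psi>]
  have eq: "AE p in P \<Otimes>\<^sub>M M. \<psi> (N' (fst p), snd p) - \<phi> (N' (fst p), snd p) \<in> {0}"
    using represents_N'[OF rep] represents_N'[OF \<psi>] by eventually_elim simp
  have "AE \<omega> in P. AE y in N' \<omega>. \<psi> (remove_point (N' \<omega>) y, y) - \<phi> (remove_point (N' \<omega>) y, y) \<in> {0}"
    by (rule AE_remove_point[OF _ eq]) measurable
  moreover have "AE \<omega> in P. AE y in M. \<Phi> (\<omega>, y) = \<phi> (N' \<omega>, y)"
    using PM.AE_pair[OF represents_N'[OF rep]] by simp
  ultimately show ?thesis
    using AE_N_eq_N' AE_space
  proof eventually_elim
    case (elim \<omega>)
    note \<eta>[measurable] = N'_lf[OF elim(4)]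
    have "(\<integral>y. \<psi> (remove_point (N' \<omega>) y, y) \<partial>N' \<omega>) = (\<integral>y. \<phi> (remove_point (N' \<omega>) y, y) \<partial>N' \<omega>)"
      using elim(1) by (intro integral_cong_AE) (auto simp: measurable_lf_cong[OF \<eta>])
    moreover have "(\<integral>y. \<Phi> (\<omega>, y) \<partial>M) = (\<integral>y. \<phi> (N' \<omega>, y) \<partial>M)"
      using elim(2,4) by (intro integral_cong_AE) auto
    ultimately show ?case
      unfolding kabanov_skorohod_def skorohod_def eps_minus_def \<psi>_def[symmetric]
      by (simp add: elim(3))
  qed
qed

lemma ex_represents:
  fixes \<Phi> :: "'w \<times> 'e \<Rightarrow> 'h::{real_inner, banach, second_countable_topology}"
  assumes gen: "generated_by P M N" and \<Phi>: "\<Phi> \<in> borel_measurable (P \<Otimes>\<^sub>M M)"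
  shows "\<exists>\<phi>. represents\<^sub>\<Omega>\<^sub>E P M N \<Phi> \<phi>"
proof -
  have T: "(\<lambda>p. (N (fst p), snd p)) \<in> measurable (P \<Otimes>\<^sub>M M) (counting_algebra M \<Otimes>\<^sub>M M)"
    by measurable
  obtain \<phi> where "\<phi> \<in> borel_measurable (counting_algebra M \<Otimes>\<^sub>M M)"
    "AE p in P \<Otimes>\<^sub>M M. \<Phi> p = \<phi> (N (fst p), snd p)"
    using AE_factorization[OF T pull_back_pair[OF N_measurable generated_by_pull_back[OF N_measurable gen]
      M.sigma_finite_measure_axioms] \<Phi>] by blast
  then show ?thesis
    by (auto simp: represents\<^sub>\<Omega>\<^sub>E_def split_beta')
qed

text \<open>
  All operators are expressed through one representing function \<open>\<phi>\<close> of \<open>\<Phi>\<close>, evaluated at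
  the modified process; then the pathwise identity applies at almost every \<open>(\<omega>, x)\<close>.
\<close>
theorem difference_kabanov_skorohod:
  fixes \<Phi> :: "'w \<times> 'e \<Rightarrow> 'h::{real_inner, banach, second_countable_topology}"
  assumes gen: "generated_by P M N" and \<Phi>: "integrable (P \<Otimes>\<^sub>M M) \<Phi>"
    and D\<Phi>: "AE x in M. integrable (P \<Otimes>\<^sub>M M) (difference\<^sub>\<Omega>\<^sub>E P M N \<Phi> x)"
  shows "AE p in P \<Otimes>\<^sub>M M.
    difference\<^sub>\<Omega> P M N (kabanov_skorohod P M N \<Phi>) (snd p) (fst p) =
      joint_version P M (\<lambda>x. kabanov_skorohod P M N (difference\<^sub>\<Omega>\<^sub>E P M N \<Phi> x)) p + \<Phi> p"
proof -
  define \<phi> where "\<phi> = (SOME \<phi>. represents\<^sub>\<Omega>\<^sub>E P M N \<Phi> \<phi>)"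
  have [measurable]: "\<Phi> \<in> borel_measurable (P \<Otimes>\<^sub>M M)"
    using \<Phi> by auto
  have \<phi>: "represents\<^sub>\<Omega>\<^sub>E P M N \<Phi> \<phi>"
    unfolding \<phi>_def using ex_represents[OF gen] by (rule someI_ex) measurable
  have \<phi>_meas[measurable]: "\<phi> \<in> borel_measurable (counting_algebra M \<Otimes>\<^sub>M M)"
    using \<phi> by (simp add: represents\<^sub>\<Omega>\<^sub>E_def)
  note [measurable] = represents_lf_measurable[OF \<phi>]
  note [measurable] = skorohod_measurable[of \<phi>]
  note \<phi>_N' = represents_N'[OF \<phi>]

  \<comment> \<open>The left-hand side: \<open>f\<close> and \<open>skorohod \<phi>\<close> both represent \<open>\<delta>(\<Phi>)\<close>, so they also agree after
    adding a point. Equality is written as membership of the difference in \<open>{0}\<close> because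
    this form is visibly measurable.\<close>
  define f where "f = (SOME f. represents\<^sub>\<Omega> P M N (kabanov_skorohod P M N \<Phi>) f)"
  have "represents\<^sub>\<Omega> P M N (kabanov_skorohod P M N \<Phi>) (\<lambda>\<eta>. skorohod \<phi> (lf_part \<eta>))"
    using kabanov_skorohod_eq_skorohod[OF _ \<phi>] by (simp add: represents\<^sub>\<Omega>_def N'_def)
  then have "represents\<^sub>\<Omega> P M N (kabanov_skorohod P M N \<Phi>) f"
    unfolding f_def by (rule someI[of "represents\<^sub>\<Omega> P M N (kabanov_skorohod P M N \<Phi>)"])
  then have f[measurable]: "f \<in> borel_measurable (counting_algebra M)"
    and fN: "AE \<omega> in P. kabanov_skorohod P M N \<Phi> \<omega> = f (N \<omega>)"
    by (auto simp: represents\<^sub>\<Omega>_def)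
  have [measurable]: "f \<in> borel_measurable lf_algebra"
    by (rule measurable_compose[OF lf_algebra_embedding f])
  have f_eq: "AE \<omega> in P. f (N' \<omega>) - skorohod \<phi> (N' \<omega>) \<in> {0}"
    using fN AE_N_eq_N' kabanov_skorohod_eq_skorohod[OF \<open>\<Phi> \<in> borel_measurable (P \<Otimes>\<^sub>M M)\<close> \<phi>]
    by eventually_elim simp
  have f_add: "AE p in P \<Otimes>\<^sub>M M. f (add_point (N' (fst p)) (snd p)) -
      skorohod \<phi> (add_point (N' (fst p)) (snd p)) \<in> {0}"
    by (rule AE_add_point[OF _ f_eq]) measurable
  have f_N: "AE p in P \<Otimes>\<^sub>M M. f (N' (fst p)) - skorohod \<phi> (N' (fst p)) \<in> {0}"
    using M.sigma_finite_measure_axioms f_eq by (rule AE_pair_fst)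

  \<comment> \<open>The right-hand side: \<open>?H\<close> is an explicit joint version, and any other one agrees with it.\<close>
  let ?\<Psi> = "\<lambda>x. difference\<^sub>\<Omega>\<^sub>E P M N \<Phi> x"
  have \<Psi>: "?\<Psi> x p = point_difference \<phi> x (N (fst p), snd p)" for x p
    by (simp add: difference\<^sub>\<Omega>\<^sub>E_def \<phi>_def[symmetric] point_difference_def split_beta)
  have \<Psi>_rep: "represents\<^sub>\<Omega>\<^sub>E P M N (?\<Psi> x) (point_difference \<phi> x)" if [measurable]: "x \<in> space M" for x
  proof -
    have "(\<lambda>z. (fst z, x)) \<in> measurable (counting_algebra M \<Otimes>\<^sub>M M) (counting_algebra M \<Otimes>\<^sub>M M)"
      by measurable
    from measurable_compose[OF this measurable_add_point]
    have [measurable]: "(\<lambda>z. add_point (fst z) x) \<in> measurable (counting_algebra M \<Otimes>\<^sub>M M) (counting_algebra M)"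
      by simp
    have "(\<lambda>z. \<phi> (add_point (fst z) x, snd z) - \<phi> (fst z, snd z)) \<in> borel_measurable (counting_algebra M \<Otimes>\<^sub>M M)"
      by measurable
    then show ?thesis
      by (simp add: represents\<^sub>\<Omega>\<^sub>E_def \<Psi> point_difference_def split_beta')
  qed
  have good: "AE x in M. x \<in> space M \<and> integrable (P \<Otimes>\<^sub>M M) (?\<Psi> x)"
    using D\<Phi> AE_space by eventually_elim simp

  let ?K = "\<lambda>x. kabanov_skorohod P M N (?\<Psi> x)"
  let ?H = "\<lambda>p. skorohod (point_difference \<phi> (snd p)) (N' (fst p))"
  have G0_meas[measurable]: "?H \<in> borel_measurable (P \<Otimes>\<^sub>M M)"
    using measurable_compose[OF _ skorohod_point_difference_measurable[of \<phi>], of "\<lambda>p. (N' (fst p), snd p)"]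
    by simp
  have G0: "AE x in M. AE \<omega> in P. ?H (\<omega>, x) = ?K x \<omega>"
    using good
  proof eventually_elim
    case (elim x)
    then have "?\<Psi> x \<in> borel_measurable (P \<Otimes>\<^sub>M M)" by auto
    from kabanov_skorohod_eq_skorohod[OF this \<Psi>_rep] elim show ?case
      by auto
  qed
  let ?G = "joint_version P M ?K"
  let ?version = "\<lambda>G. G \<in> borel_measurable (P \<Otimes>\<^sub>M M) \<and> (AE x in M. AE \<omega> in P. G (\<omega>, x) = ?K x \<omega>)"
  have "?version ?H"
    using G0_meas G0 by (rule conjI)
  then have "?version (SOME G. ?version G)"
    by (rule someI[of ?version])
  then have "?version ?G"
    by (simp only: joint_version_def[symmetric])
  then have G_meas[measurable]: "?G \<in> borel_measurable (P \<Otimes>\<^sub>M M)"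
    and G: "AE x in M. AE \<omega> in P. ?G (\<omega>, x) = ?K x \<omega>"
    by auto
  have G_eq: "AE p in P \<Otimes>\<^sub>M M. ?G p - ?H p \<in> {0}"
  proof (rule AE_swap)
    show "AE x in M. AE \<omega> in P. ?G (\<omega>, x) - ?H (\<omega>, x) \<in> {0}"
      using G G0
    proof eventually_elim
      case (elim x)
      then show ?case by eventually_elim simp
    qed
  qed measurable

  \<comment> \<open>The hypotheses of the pathwise identity. For the difference of \<open>\<phi>\<close> integrability is known only
    for almost every fixed \<open>x\<close>; as finiteness of an integral it is a measurable condition on
    \<open>(\<omega>, x)\<close>.\<close>
  have int_\<phi>: "integrable (P \<Otimes>\<^sub>M M) (\<lambda>p. \<phi> (N' (fst p), snd p))"
    using integrable_cong_AE[THEN iffD1, OF _ _ \<phi>_N' \<Phi>] by simp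
  have 1: "AE p in P \<Otimes>\<^sub>M M. (\<integral>\<^sup>+y. norm (\<phi> (remove_point (N' (fst p)) y, y)) \<partial>N' (fst p)) < \<infinity>"
    by (rule AE_pair_fst[OF M.sigma_finite_measure_axioms AE_integrable_remove_point[OF _ int_\<phi>]]) measurable
  have 2: "AE p in P \<Otimes>\<^sub>M M. integrable M (\<lambda>y. \<phi> (N' (fst p), y))"
    using PM.AE_integrable_fst'[OF int_\<phi>]
    by (intro AE_pair_fst[OF M.sigma_finite_measure_axioms]) simp
  have int_\<Psi>: "integrable (P \<Otimes>\<^sub>M M) (\<lambda>p. point_difference \<phi> x (N' (fst p), snd p))"
    if x[measurable]: "x \<in> space M" and int: "integrable (P \<Otimes>\<^sub>M M) (?\<Psi> x)" for x
  proof -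
    have [measurable]: "point_difference \<phi> x \<in> borel_measurable (lf_algebra \<Otimes>\<^sub>M M)"
      by (rule represents_lf_measurable[OF \<Psi>_rep[OF x]])
    show ?thesis
      using integrable_cong_AE[THEN iffD1, OF _ _ represents_N'[OF \<Psi>_rep[OF x]] int] int by simp
  qed
  have 3: "AE p in P \<Otimes>\<^sub>M M.
      (\<integral>\<^sup>+y. norm (point_difference \<phi> (snd p) (remove_point (N' (fst p)) y, y)) \<partial>N' (fst p)) < \<infinity>"
  proof (rule AE_swap)
    have [measurable]: "(\<lambda>p. \<integral>\<^sup>+y. norm (point_difference \<phi> (snd p) (remove_point (N' (fst p)) y, y)) \<partial>N' (fst p))
        \<in> borel_measurable (P \<Otimes>\<^sub>M M)"
      using borel_measurable_nn_integral_lf[of "\<lambda>p. N' (fst p)" "P \<Otimes>\<^sub>M M"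
        "\<lambda>u. norm (point_difference \<phi> (snd (fst u)) (remove_point (N' (fst (fst u))) (snd u), snd u))"]
      by (simp add: point_difference_def)
    show "Measurable.pred (P \<Otimes>\<^sub>M M) (\<lambda>p.
      (\<integral>\<^sup>+y. norm (point_difference \<phi> (snd p) (remove_point (N' (fst p)) y, y)) \<partial>N' (fst p)) < \<infinity>)"
      by measurable
    show "AE x in M. AE \<omega> in P. (\<integral>\<^sup>+y. norm (point_difference \<phi> (snd (\<omega>, x))
        (remove_point (N' (fst (\<omega>, x))) y, y)) \<partial>N' (fst (\<omega>, x))) < \<infinity>"
      using good
    proof eventually_elim
      case (elim x)
      then show ?case
        using AE_integrable_remove_point[OF represents_lf_measurable[OF \<Psi>_rep] int_\<Psi>, of x] by simp
    qed
  qed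
  have 4: "AE p in P \<Otimes>\<^sub>M M. (\<integral>\<^sup>+y. norm (point_difference \<phi> (snd p) (N' (fst p), y)) \<partial>M) < \<infinity>"
  proof (rule AE_swap)
    show "Measurable.pred (P \<Otimes>\<^sub>M M) (\<lambda>p.
      (\<integral>\<^sup>+y. norm (point_difference \<phi> (snd p) (N' (fst p), y)) \<partial>M) < \<infinity>)"
      unfolding point_difference_def by simp
    show "AE x in M. AE \<omega> in P. (\<integral>\<^sup>+y. norm (point_difference \<phi> (snd (\<omega>, x)) (N' (fst (\<omega>, x)), y)) \<partial>M) < \<infinity>"
      using good
    proof eventually_elim
      case (elim x)
      then show ?case
        using PM.AE_integrable_fst'[OF int_\<Psi>, of x] by (simp add: integrable_iff_bounded)
    qed
  qed
  have 5: "AE p in P \<Otimes>\<^sub>M M. AE y in N' (fst p). 1 \<le> emeasure (N' (fst p)) {y}"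
    using M.sigma_finite_measure_axioms AE_atoms by (rule AE_pair_fst)
  show ?thesis
    using AE_space AE_pair_N_eq_N' f_add f_N G_eq \<phi>_N' 1 2 3 4 5
  proof eventually_elim
    case (elim p)
    let ?\<eta> = "N' (fst p)" and ?x = "snd p"
    have \<eta>[measurable]: "?\<eta> \<in> space lf_algebra" and x[measurable]: "?x \<in> space M"
      using elim(1) N'_lf by (auto simp: space_pair_measure)
    have [measurable]: "point_difference \<phi> ?x \<in> borel_measurable (lf_algebra \<Otimes>\<^sub>M M)"
      by (rule represents_lf_measurable[OF \<Psi>_rep[OF x]])
    have "difference\<^sub>\<Omega> P M N (kabanov_skorohod P M N \<Phi>) ?x (fst p) =
        skorohod \<phi> (add_point ?\<eta> ?x) - skorohod \<phi> ?\<eta>"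
      using elim(2,3,4) by (simp add: difference\<^sub>\<Omega>_def f_def[symmetric])
    also have "\<dots> = skorohod (point_difference \<phi> ?x) ?\<eta> + \<phi> (?\<eta>, ?x)"
    proof (rule skorohod_add_point[OF _ \<eta> x elim(11)])
      show "integrable ?\<eta> (\<lambda>y. \<phi> (remove_point ?\<eta> y, y))"
        using elim(7) by (intro integrableI_bounded) (auto simp: measurable_lf_cong[OF \<eta>])
      show "integrable ?\<eta> (\<lambda>y. point_difference \<phi> ?x (remove_point ?\<eta> y, y))"
        using elim(9) by (intro integrableI_bounded) (auto simp: measurable_lf_cong[OF \<eta>])
      show "integrable M (\<lambda>y. \<phi> (?\<eta>, y))"
        by (rule elim(8))
      show "integrable M (\<lambda>y. point_difference \<phi> ?x (?\<eta>, y))"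
        using elim(10) by (intro integrableI_bounded) auto
    qed measurable
    also have "\<dots> = ?G p + \<Phi> p"
      using elim(5,6) by simp
    finally show ?case .
  qed
qed

end

theorem proposition3p21:
  fixes P :: "'w measure" and M :: "'e measure"
    and N :: "'w \<Rightarrow> 'e measure" and X :: "nat \<Rightarrow> 'w \<Rightarrow> 'e"
    and \<Phi> :: "'w \<times> 'e \<Rightarrow> 'h::{real_inner,banach,second_countable_topology}"
  assumes "sigma_finite_measure M"
    and "measurable_diagonal M"
    and "prob_space P"
    and "complete_measure P"
    and "poisson_random_measure P M N"
    and "represented_by P M N X"
    and "generated_by P M N"
    and "borel_space M"
    and "integrable (P \<Otimes>\<^sub>M M) \<Phi>"
    and "AE x in M. integrable (P \<Otimes>\<^sub>M M) (difference\<^sub>\<Omega>\<^sub>E P M N \<Phi> x)"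
  shows "AE (\<omega>, x) in P \<Otimes>\<^sub>M M.
    difference\<^sub>\<Omega> P M N (kabanov_skorohod P M N \<Phi>) x \<omega> =
      joint_version P M (\<lambda>x. kabanov_skorohod P M N (difference\<^sub>\<Omega>\<^sub>E P M N \<Phi> x)) (\<omega>, x) + \<Phi> (\<omega>, x)"
proof -
  obtain B :: "nat \<Rightarrow> 'e set" where B: "range B \<subseteq> sets M" "(\<Union>n. B n) = space M"
    "\<And>n. emeasure M (B n) \<noteq> \<infinity>" "incseq B"
    by (rule sigma_finite_measure.sigma_finite_incseq[OF assms(1)]) blast
  interpret represented_poisson_process M B P N X
    using assms B
    by (intro represented_poisson_process.intro exhausted_space.intro
        represented_poisson_process_axioms.intro) (auto simp: less_top)
  from difference_kabanov_skorohod[OF assms(7,9,10)] show ?thesis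
    by (simp add: split_beta')
qed

end
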